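(* Let $L(z)$ be a normalized degree distribution with minimum degree $l_1\ge2$. Then $$r_{L(z^k)}\Big(\frac{\ln k}{2k},h\Big)=O\Big(\frac{\ln^2k}{k}\Big)$$ for any (integer) $k\ge e^{2/l_1}$ and any $h\ge0$.
   Context: A normalized degree distribution is a polynomial $L(z)=\sum_{i=1}^{L}L_iz^{l_i}$ with integers $1\le l_1<\dots<l_L$, $L_i>0$, $\sum_iL_i=1$; $l_1$ is its minimum degree and $\bar l=L'(1)=\sum_iL_il_i$. For a positive integer $k$, $L(z^k)$ is again a normalized degree distribution, with minimum degree $kl_1$ and average degree $k\bar l$. The $O(\cdot)$ is with respect to $k$, for fixed $L(z)$. The quantity $r_{L(z)}(\epsilon,h)$ is defined as follows for a degree distribution $L(z)$ with minimum degree $l_1$ and average degree $\bar l$ (for $L(z^k)$ replace $l_1,\bar l$ by $kl_1,k\bar l$ throughout). Put $r_1=\lfloor\bar l\rfloor$, $r_2=\lceil\bar l\rceil$, $R_1=1+\lfloor\bar l\rfloor-\bar l$, $R_2=\bar l-\lfloor\bar l\rfloor$. $\mathrm H$ and $\mathrm H_e$ are the binary entropy functions in base 2 and base $e$. $\pi(m)=0$ for even $m$, $1$ for odd $m$; $g(\tau,k)=(1+\tau)^k+(1-\tau)^k$. For real $R\in(0,1]$ let $c=c(R)=2^{-\lceil\log_2R\rceil}$ and $\theta_1=\min\{2R-\frac1c,\frac{R_1}{c}\}$, $\theta_2=\max\{\frac{R_1}{2c}-(R-\frac1{2c}),0\}$, $\theta_3=\max\{\frac{R_2}{c}-2(\frac1c-R),0\}$,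 $\theta_4=\min\{\frac1c-R,\frac{R_2}{2c}\}$, $\xi_{\max}=\bar l-\theta_1\pi(cr_1)-\theta_3\pi(cr_2)$. For $0<\xi<\xi_{\max}$, $$P(R,\bar l,\xi)=-\bar l\,\mathrm H_e(\xi/\bar l)-\xi\ln\tau+\theta_1\ln\tfrac{g(\tau,r_1c)}2+\theta_2\ln\tfrac{g(\tau,2r_1c)}2+\theta_3\ln\tfrac{g(\tau,r_2c)}2+\theta_4\ln\tfrac{g(\tau,2r_2c)}2,$$ where $\tau\in[0,\infty)$ is the unique solution of $$r_1c\,\theta_1\tfrac{g(\tau,r_1c-1)}{g(\tau,r_1c)}+2r_1c\,\theta_2\tfrac{g(\tau,2r_1c-1)}{g(\tau,2r_1c)}+r_2c\,\theta_3\tfrac{g(\tau,r_2c-1)}{g(\tau,r_2c)}+2r_2c\,\theta_4\tfrac{g(\tau,2r_2c-1)}{g(\tau,2r_2c)}=\bar l-\xi.$$ For $\xi=\xi_{\max}$ the formula is read as its limit when $\tau\to+\infty$; for $\xi_{\max}<\xi\le\bar l$, $P=-\infty$. Let $n$ range over powers of 2 and $\Delta=\Delta_n$ be positive integers with $n/\Delta$ an integer and $\Delta_n/\sqrt n\to1$. Put $\Gamma_{n/\Delta}=\frac1{\ln2}\big[-P(1,\bar l,l_1\epsilon)-\frac{3\lceil\bar l\rceil}\Delta\ln\frac{n\bar l}2-\frac1{2n}\ln\frac{n\bar l}4\big]-\frac\Delta n$. For $h\ge0$, $R^{(\Delta)}_{L(z)}(\epsilon,h)$ is the positive solution $R$ of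 $-P(R,\bar l,l_1\epsilon)=[h+\frac\Delta n]\ln2+\frac{3\lceil\bar l\rceil}\Delta\ln\frac{n\bar l}2+\frac1{2n}\ln\frac{n\bar l}4$ if $h\le\Gamma_{n/\Delta}$, and $R^{(\Delta)}_{L(z)}(\epsilon,h)=2+\frac1{\ln2}\big[P(1,\bar l,l_1\epsilon)+\frac{3\lceil\bar l\rceil}n\ln\frac{n\bar l}2+\frac1{2n}\ln\frac{n\bar l}4\big]$ otherwise. Define $$R_{L(z)}(\epsilon,h)=\lim_{n\to\infty}R^{(\Delta)}_{L(z)}(\epsilon,h),\qquad r_{L(z)}(\epsilon,h)=R_{L(z)}(\epsilon,h)+\mathrm H(\epsilon)-h.$$
   Formalization: For h > 1 only the upper bound r ≤ C ln²k/k is claimed, since there r tends to 1 − h < 0 as k grows and the two-sided O(ln²k/k) is false; for 0 ≤ h ≤ 1 the bound is on |r|. *)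

theory Defs
  imports Complex_Main
    "HOL-Computational_Algebra.Polynomial"
    "HOL-Library.Extended_Real"
begin

definition normalized_degree_distribution :: "real poly \<Rightarrow> bool" where
  "normalized_degree_distribution L \<longleftrightarrow>
     (\<forall>i. coeff L i \<ge> 0) \<and> coeff L 0 = 0 \<and> (\<Sum>i\<le>degree L. coeff L i) = 1"

definition min_degree :: "real poly \<Rightarrow> nat" where
  "min_degree L = (LEAST i. coeff L i \<noteq> 0)"

definition avg_degree :: "real poly \<Rightarrow> real" where
  "avg_degree L = poly (pderiv L) 1"

definition entropy_e :: "real \<Rightarrow> real" where
  "entropy_e x = - x * ln x - (1 - x) * ln (1 - x)"

definition entropy_2 :: "real \<Rightarrow> real" where
  "entropy_2 x = - x * log 2 x - (1 - x) * log 2 (1 - x)"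

definition par :: "nat \<Rightarrow> real" where
  "par m = (if even m then 0 else 1)"

definition g :: "real \<Rightarrow> nat \<Rightarrow> real" where
  "g \<tau> k = (1 + \<tau>) ^ k + (1 - \<tau>) ^ k"

text \<open>In what follows \<open>l\<close> is the average degree (\<open>l \<ge> 1\<close>) and \<open>0 < R \<le> 1\<close>.\<close>

definition r1 :: "real \<Rightarrow> nat" where "r1 l = nat \<lfloor>l\<rfloor>"
definition r2 :: "real \<Rightarrow> nat" where "r2 l = nat \<lceil>l\<rceil>"

definition R1 :: "real \<Rightarrow> real" where "R1 l = 1 + of_int \<lfloor>l\<rfloor> - l"
definition R2 :: "real \<Rightarrow> real" where "R2 l = l - of_int \<lfloor>l\<rfloor>"

text \<open>The exponent is non-negative because \<open>R \<le> 1\<close>, so this is a positive integer.\<close>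

definition cc :: "real \<Rightarrow> nat" where
  "cc R = 2 ^ nat (- \<lceil>log 2 R\<rceil>)"

definition \<theta>1 :: "real \<Rightarrow> real \<Rightarrow> real" where
  "\<theta>1 R l = min (2 * R - 1 / real (cc R)) (R1 l / real (cc R))"
definition \<theta>2 :: "real \<Rightarrow> real \<Rightarrow> real" where
  "\<theta>2 R l = max (R1 l / (2 * real (cc R)) - (R - 1 / (2 * real (cc R)))) 0"
definition \<theta>3 :: "real \<Rightarrow> real \<Rightarrow> real" where
  "\<theta>3 R l = max (R2 l / real (cc R) - 2 * (1 / real (cc R) - R)) 0"
definition \<theta>4 :: "real \<Rightarrow> real \<Rightarrow> real" where
  "\<theta>4 R l = min (1 / real (cc R) - R) (R2 l / (2 * real (cc R)))"

definition \<xi>max :: "real \<Rightarrow> real \<Rightarrow> real" where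
  "\<xi>max R l = l - \<theta>1 R l * par (cc R * r1 l) - \<theta>3 R l * par (cc R * r2 l)"

definition P_formula :: "real \<Rightarrow> real \<Rightarrow> real \<Rightarrow> real \<Rightarrow> real" where
  "P_formula R l \<xi> \<tau> =
     - l * entropy_e (\<xi> / l) - \<xi> * ln \<tau>
     + \<theta>1 R l * ln (g \<tau> (r1 l * cc R) / 2)
     + \<theta>2 R l * ln (g \<tau> (2 * r1 l * cc R) / 2)
     + \<theta>3 R l * ln (g \<tau> (r2 l * cc R) / 2)
     + \<theta>4 R l * ln (g \<tau> (2 * r2 l * cc R) / 2)"

definition saddle_lhs :: "real \<Rightarrow> real \<Rightarrow> real \<Rightarrow> real" where
  "saddle_lhs R l \<tau> =
     (let a = r1 l * cc R; b = r2 l * cc R in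
       real a * \<theta>1 R l * (g \<tau> (a - 1) / g \<tau> a)
     + 2 * real a * \<theta>2 R l * (g \<tau> (2 * a - 1) / g \<tau> (2 * a))
     + real b * \<theta>3 R l * (g \<tau> (b - 1) / g \<tau> b)
     + 2 * real b * \<theta>4 R l * (g \<tau> (2 * b - 1) / g \<tau> (2 * b)))"

definition saddle_point :: "real \<Rightarrow> real \<Rightarrow> real \<Rightarrow> real" where
  "saddle_point R l \<xi> = (THE \<tau>. 0 \<le> \<tau> \<and> saddle_lhs R l \<tau> = l - \<xi>)"

definition P :: "real \<Rightarrow> real \<Rightarrow> real \<Rightarrow> ereal" where
  "P R l \<xi> =
     (if 0 < \<xi> \<and> \<xi> < \<xi>max R l then ereal (P_formula R l \<xi> (saddle_point R l \<xi>))
      else if 0 < \<xi> \<and> \<xi> = \<xi>max R l then ereal (Lim at_top (P_formula R l \<xi>))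
      else if \<xi>max R l < \<xi> \<and> \<xi> \<le> l then - \<infinity>
      else undefined)"

definition \<Gamma> :: "nat \<Rightarrow> nat \<Rightarrow> real poly \<Rightarrow> real \<Rightarrow> ereal" where
  "\<Gamma> n \<Delta> L \<epsilon> =
     (let l = avg_degree L in
       ereal (1 / ln 2) *
         (- P 1 l (real (min_degree L) * \<epsilon>)
          - ereal (3 * of_int \<lceil>l\<rceil> / real \<Delta> * ln (real n * l / 2)
                   + 1 / (2 * real n) * ln (real n * l / 4)))
       - ereal (real \<Delta> / real n))"

text \<open>
  In the second branch \<open>\<Gamma> < \<infinity>\<close>, hence \<open>P 1 l _\<close> is finite there.
\<close>

definition R_finite :: "nat \<Rightarrow> nat \<Rightarrow> real poly \<Rightarrow> real \<Rightarrow> real \<Rightarrow> real" where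
  "R_finite n \<Delta> L \<epsilon> h =
     (let l = avg_degree L; \<xi> = real (min_degree L) * \<epsilon> in
      if ereal h \<le> \<Gamma> n \<Delta> L \<epsilon>
      then (THE R. 0 < R \<and> R \<le> 1 \<and>
              - P R l \<xi> = ereal ((h + real \<Delta> / real n) * ln 2
                 + 3 * of_int \<lceil>l\<rceil> / real \<Delta> * ln (real n * l / 2)
                 + 1 / (2 * real n) * ln (real n * l / 4)))
      else 2 + 1 / ln 2 * (real_of_ereal (P 1 l \<xi>)
                 + 3 * of_int \<lceil>l\<rceil> / real n * ln (real n * l / 2)
                 + 1 / (2 * real n) * ln (real n * l / 4)))"

text \<open>
  \<open>n j\<close> is a sequence of powers of two tending to infinity, and \<open>\<Delta> j\<close> belongs to \<open>n j\<close>.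
  The sequence need not run through all powers of two, and it cannot: \<open>\<Delta> j\<close> divides
  \<open>n j\<close>, so it is itself a power of two, and \<open>\<Delta> j / sqrt (n j)\<close> can only tend to 1
  if almost all \<open>n j\<close> are powers of four.
\<close>

definition admissible :: "(nat \<Rightarrow> nat) \<Rightarrow> (nat \<Rightarrow> nat) \<Rightarrow> bool" where
  "admissible n \<Delta> \<longleftrightarrow>
     (\<forall>j. \<exists>m. n j = 2 ^ m) \<and> filterlim n at_top sequentially \<and>
     (\<forall>j. \<Delta> j > 0 \<and> \<Delta> j dvd n j) \<and>
     (\<lambda>j. real (\<Delta> j) / sqrt (real (n j))) \<longlonglongrightarrow> 1"

definition R_lim :: "(nat \<Rightarrow> nat) \<Rightarrow> (nat \<Rightarrow> nat) \<Rightarrow> real poly \<Rightarrow> real \<Rightarrow> real \<Rightarrow> real" where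
  "R_lim n \<Delta> L \<epsilon> h = lim (\<lambda>j. R_finite (n j) (\<Delta> j) L \<epsilon> h)"

definition r_lim :: "(nat \<Rightarrow> nat) \<Rightarrow> (nat \<Rightarrow> nat) \<Rightarrow> real poly \<Rightarrow> real \<Rightarrow> real \<Rightarrow> real" where
  "r_lim n \<Delta> L \<epsilon> h = R_lim n \<Delta> L \<epsilon> h + entropy_2 \<epsilon> - h"

definition expand :: "real poly \<Rightarrow> nat \<Rightarrow> real poly" where
  "expand L k = pcompose L (monom 1 k)"

text \<open>
  For \<open>h > 1\<close> no two-sided bound on \<open>r_lim\<close> of order \<open>(ln k)\<^sup>2 / k\<close> is possible: as
  \<open>k\<close> grows, \<open>R_lim\<close> tends to 1 and \<open>r_lim\<close> to \<open>1 - h < 0\<close>. Big-O estimates of the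
  redundancy are therefore to be read as upper bounds for all \<open>h \<ge> 0\<close> and as bounds on
  the absolute value for \<open>h \<le> 1\<close>.
\<close>

end

theory Submission
  imports Defs "HOL-Real_Asymp.Real_Asymp" "HOL-Analysis.Lipschitz"
begin

text \<open>
  The four check-node weights sum to \<open>R\<close> and, weighted by the degrees, to \<open>l\<close>; the saddle-point
  equation is therefore the critical-point equation of \<open>P_formula\<close> in \<open>\<tau>\<close>. For \<open>\<xi> < l / 2\<close> its only
  root lies in \<open>(0, 1)\<close> and minimizes \<open>P_formula\<close> there. With \<open>x = (1 - \<tau>) / (1 + \<tau>)\<close> the formula splits
  into a part \<open>B(\<tau>) \<ge> 0\<close> that does not involve \<open>R\<close> and vanishes at \<open>\<tau> = \<xi> / (l - \<xi>)\<close>, plus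
  \<open>\<Sum>\<^sub>i \<theta>\<^sub>i ln ((1 + x ^ d\<^sub>i) / 2)\<close>. For fixed \<open>0 \<le> x < 1\<close> the latter is strictly decreasing and
  \<open>ln 2\<close>-Lipschitz in \<open>R\<close>, and both properties pass to the minimum \<open>P R\<close>. So the equation for
  \<open>R\<close> has exactly one solution, which depends continuously on the right-hand side, and the limit
  over \<open>n\<close> exists. Bounding the minimum from below by \<open>x ^ d \<ge> 0\<close> and from above by its value at
  \<open>\<xi> / (l - \<xi>)\<close> gives \<open>R ln 2 - (1 - 2 \<xi> / l) ^ r1 l \<le> - P R \<le> R ln 2\<close>, and for
  \<open>L(z\<^sup>k)\<close> and \<open>\<epsilon> = ln k / (2 k)\<close> the error term is \<open>O(1 / k\<^sup>2)\<close>. Hence the entropy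
  \<open>H \<epsilon>\<close>, of order \<open>ln\<^sup>2 k / k\<close>, dominates the redundancy.
\<close>

subsection \<open>The ratio \<open>g(\<tau>, d - 1) / g(\<tau>, d)\<close>\<close>

lemma g_pos:
  assumes "0 \<le> \<tau>" shows "g \<tau> d > 0"
proof (cases "\<tau> = 0 \<or> d = 0")
  case False
  then have "\<bar>1 - \<tau>\<bar> < 1 + \<tau>" using assms by auto
  then have "\<bar>1 - \<tau>\<bar> ^ d < (1 + \<tau>) ^ d"
    using False by (intro power_strict_mono) auto
  then have "\<bar>(1 - \<tau>) ^ d\<bar> < (1 + \<tau>) ^ d" by (simp add: power_abs)
  then show ?thesis unfolding g_def by linarith
qed (auto simp: g_def)

text \<open>\<open>2 * g \<tau> (d - 1) - g \<tau> d\<close> factors as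
  \<open>(1 - \<tau>) * (1 + \<tau>) * g \<tau> (d - 2)\<close>, which is negative past 1.\<close>

lemma g_ratio_less_half:
  assumes "1 < \<tau>" "2 \<le> d" shows "g \<tau> (d - 1) / g \<tau> d < 1 / 2"
proof -
  obtain m where d: "d = Suc (Suc m)"
    using assms(2) nat_le_iff_add[of 2 d] by auto
  have "2 * g \<tau> (Suc m) - g \<tau> d = (1 - \<tau>) * ((1 + \<tau>) * g \<tau> m)"
    unfolding d g_def by (simp add: algebra_simps)
  moreover have "(1 - \<tau>) * ((1 + \<tau>) * g \<tau> m) < 0"
    using assms g_pos[of \<tau> m] by (intro mult_neg_pos mult_pos_pos) auto
  ultimately have "2 * g \<tau> (d - 1) < g \<tau> d" using d by simp
  then show ?thesis using g_pos[of \<tau> d] assms by (simp add: divide_simps)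
qed

text \<open>After cross-multiplication the difference of the two sides is
  \<open>(y - x) * (1 - (x * y) ^ m)\<close>, which is positive, plus
  \<open>(y ^ m - x ^ m) * (1 - x * y)\<close>, which is nonnegative.\<close>

lemma mirror_power_ratio_strict_mono:
  fixes x y :: real
  assumes "0 \<le> x" "x < y" "y \<le> 1" "0 < m"
  shows "(x + x ^ m) / (1 + x ^ Suc m) < (y + y ^ m) / (1 + y ^ Suc m)"
proof -
  have pos: "0 < 1 + x ^ Suc m" "0 < 1 + y ^ Suc m"
    using assms by (auto intro!: add_pos_nonneg)
  have xy: "x * y < 1" using mult_left_mono[of y 1 x] assms by auto
  then have "(x * y) ^ m < 1" 
    using assms by (intro power_less_one_iff[THEN iffD2]) auto
  then have a: "0 < (y - x) * (1 - (x * y) ^ m)" using assms by (intro mult_pos_pos) auto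
  have b: "0 \<le> (y ^ m - x ^ m) * (1 - x * y)"
    using assms xy by (intro mult_nonneg_nonneg) (auto intro: power_mono)
  have "(y + y ^ m) * (1 + x ^ Suc m) - (x + x ^ m) * (1 + y ^ Suc m)
      = (y - x) * (1 - (x * y) ^ m) + (y ^ m - x ^ m) * (1 - x * y)"
    by (simp add: algebra_simps power_mult_distrib)
  then have "(x + x ^ m) * (1 + y ^ Suc m) < (y + y ^ m) * (1 + x ^ Suc m)"
    using a b by linarith
  then show ?thesis using pos by (simp add: divide_simps)
qed

text \<open>The Moebius involution exchanging 0 and 1. For \<open>\<tau> = p / (1 - p)\<close> it
  yields \<open>1 - 2 * p\<close>, the bias of a bit that is 1 with probability
  \<open>p\<close>.\<close>

definition mob :: "real \<Rightarrow> real" where "mob \<tau> = (1 - \<tau>) / (1 + \<tau>)"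

lemma mob_range: "0 \<le> \<tau> \<Longrightarrow> \<tau> \<le> 1 \<Longrightarrow> 0 \<le> mob \<tau> \<and> mob \<tau> \<le> 1"
  by (auto simp: mob_def divide_simps)

lemma mob_less_one: "0 < \<tau> \<Longrightarrow> mob \<tau> < 1"
  by (auto simp: mob_def divide_simps)

lemma mob_strict_antimono: "0 \<le> s \<Longrightarrow> s < t \<Longrightarrow> mob t < mob s"
  by (auto simp: mob_def divide_simps algebra_simps)

lemma g_eq_mob: "0 \<le> \<tau> \<Longrightarrow> g \<tau> d = (1 + \<tau>) ^ d * (1 + mob \<tau> ^ d)"
  by (simp add: g_def mob_def power_divide algebra_simps)

lemma g_ratio_mob:
  assumes "0 \<le> \<tau>" "\<tau> \<le> 1"
  shows "g \<tau> m / g \<tau> (Suc m) = (1 + (mob \<tau> + mob \<tau> ^ m) / (1 + mob \<tau> ^ Suc m)) / 2"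
proof -
  define x where "x = mob \<tau>"
  have x: "0 \<le> x" using mob_range[OF assms] by (simp add: x_def)
  have pos: "1 + x ^ Suc m > 0" using x by (intro add_pos_nonneg) auto
  have t: "1 + x = 2 / (1 + \<tau>)" using assms by (simp add: x_def mob_def divide_simps)
  have "g \<tau> m / g \<tau> (Suc m) = (1 + x ^ m) / (1 + x ^ Suc m) * (1 / (1 + \<tau>))"
    using assms by (simp add: g_eq_mob x_def[symmetric] divide_simps)
  also have "1 / (1 + \<tau>) = (1 + x) / 2" using assms unfolding t by (simp add: divide_simps)
  also have "(1 + x ^ m) / (1 + x ^ Suc m) * ((1 + x) / 2)
     = (1 + (x + x ^ m) / (1 + x ^ Suc m)) / 2"
    using pos by (simp add: divide_simps) (simp add: algebra_simps)
  finally show ?thesis by (simp add: x_def)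
qed

text \<open>Composition of the decreasing \<open>mob\<close> with an increasing function;
  \<open>t \<le> 1\<close> keeps \<open>mob\<close> nonnegative, as
  \<open>mirror_power_ratio_strict_mono\<close> requires.\<close>

lemma g_ratio_strict_antimono:
  assumes "0 \<le> s" "s < t" "t \<le> 1" "2 \<le> d"
  shows "g t (d - 1) / g t d < g s (d - 1) / g s d"
proof -
  obtain m where d: "d = Suc m" "0 < m"
    using assms(4) by (cases d) auto
  have less: "(mob t + mob t ^ m) / (1 + mob t ^ Suc m) < (mob s + mob s ^ m) / (1 + mob s ^ Suc m)"
    using assms d mob_range[of s] mob_range[of t]
    by (intro mirror_power_ratio_strict_mono mob_strict_antimono) auto
  have eq: "g s m / g s (Suc m) = (1 + (mob s + mob s ^ m) / (1 + mob s ^ Suc m)) / 2"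
    "g t m / g t (Suc m) = (1 + (mob t + mob t ^ m) / (1 + mob t ^ Suc m)) / 2"
    by (rule g_ratio_mob; use assms in simp)+
  show ?thesis
    unfolding d(1) diff_Suc_1 eq
    by (intro divide_strict_right_mono add_strict_left_mono less) simp
qed

subsection \<open>Check-node degrees and weights\<close>

text \<open>\<open>1 / cc R\<close> is the least power of two that is at least
  \<open>R\<close>.\<close>

lemma cc_bounds:
  assumes "0 < R" "R \<le> 1"
  shows "1 / (2 * real (cc R)) < R" "R \<le> 1 / real (cc R)"
proof -
  define t where "t = \<lceil>log 2 R\<rceil>"
  have t0: "t \<le> 0" using assms by (simp add: t_def ceiling_le_iff)
  have c: "real (cc R) = 2 powr (- real_of_int t)"
    using t0 unfolding cc_def t_def[symmetric] by (simp add: powr_realpow[symmetric])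
  have R: "R = 2 powr (log 2 R)" using assms by simp
  have "2 powr (real_of_int t - 1) < 2 powr (log 2 R)"
    unfolding t_def by (intro powr_less_mono) linarith+
  then show "1 / (2 * real (cc R)) < R"
    using R unfolding c by (simp add: powr_minus powr_diff divide_simps)
  have "2 powr (log 2 R) \<le> 2 powr (real_of_int t)"
    unfolding t_def by (intro powr_mono) linarith+
  then show "R \<le> 1 / real (cc R)"
    using R unfolding c by (simp add: powr_minus divide_simps)
qed

lemma cc_unique:
  assumes "1 / (2 * 2 ^ m) < R" "R \<le> 1 / 2 ^ m"
  shows "cc R = 2 ^ m"
proof -
  have R0: "0 < R" using assms(1) by (rule less_trans[rotated]) simp
  have "log 2 R \<le> log 2 (1 / 2 ^ m)" using assms R0 by simp
  moreover have "log 2 (1 / (2 * 2 ^ m)) < log 2 R" using assms R0 by simp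
  ultimately have "\<lceil>log 2 R\<rceil> = - int m"
    by (simp add: log_divide log_mult log_nat_power ceiling_eq_iff)
  then show ?thesis by (simp add: cc_def)
qed

text \<open>Numbering the four check-node classes lets the estimates run as weighted sums over
  \<open>i < 4\<close>.\<close>

definition node_deg :: "real \<Rightarrow> real \<Rightarrow> nat \<Rightarrow> nat" where
  "node_deg R l i = [r1 l * cc R, 2 * r1 l * cc R, r2 l * cc R, 2 * r2 l * cc R] ! i"

definition node_wt :: "real \<Rightarrow> real \<Rightarrow> nat \<Rightarrow> real" where
  "node_wt R l i = [\<theta>1 R l, \<theta>2 R l, \<theta>3 R l, \<theta>4 R l] ! i"

lemma sum_four: "(\<Sum>i<4. f i) = f 0 + f 1 + f 2 + (f 3 :: real)" for f :: "nat \<Rightarrow> real"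
  by (simp add: eval_nat_numeral)

lemma R12_range: "0 \<le> R1 l" "R1 l \<le> 1" "0 \<le> R2 l" "R2 l < 1" "R1 l + R2 l = 1"
  unfolding R1_def R2_def by linarith+

lemma R12_mean:
  assumes "0 \<le> l" shows "R1 l * real (r1 l) + R2 l * real (r2 l) = l"
proof (cases "l = of_int \<lfloor>l\<rfloor>")
  case True
  then have "real (r1 l) = l" using assms by (simp add: r1_def)
  then show ?thesis using True by (simp add: R1_def R2_def)
next
  case False
  then have "\<lceil>l\<rceil> = \<lfloor>l\<rfloor> + 1" by (simp add: ceiling_altdef)
  moreover have "0 \<le> \<lfloor>l\<rfloor>" using assms by simp
  ultimately have "real (r1 l) = of_int \<lfloor>l\<rfloor>" "real (r2 l) = of_int \<lfloor>l\<rfloor> + 1"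
    by (simp_all add: r1_def r2_def)
  then show ?thesis by (simp add: R1_def R2_def algebra_simps)
qed

lemma r12_ge: "real m \<le> l \<Longrightarrow> m \<le> r1 l \<and> m \<le> r2 l"
  unfolding r1_def r2_def by linarith

text \<open>Of the weight \<open>R1 l / cc R\<close> at degree \<open>r1 l * cc R\<close>, the part
  \<open>\<theta>1\<close> stays; the rest is merged in pairs, which halves the weight and doubles
  the degree. \<open>\<theta>4_alt\<close> plays this role for \<open>r2 l\<close>.\<close>

lemma \<theta>2_alt: "\<theta>2 R l = (R1 l / real (cc R) - \<theta>1 R l) / 2"
  unfolding \<theta>1_def \<theta>2_def by (simp add: min_def max_def field_simps)

lemma \<theta>3_alt: "\<theta>3 R l = max (2 * R - 1 / real (cc R) - R1 l / real (cc R)) 0"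
proof -
  have R2: "R2 l = 1 - R1 l" using R12_range(5)[of l] by simp
  show ?thesis unfolding \<theta>3_def R2 by (simp add: diff_divide_distrib)
qed

lemma \<theta>4_alt: "\<theta>4 R l = (R2 l / real (cc R) - \<theta>3 R l) / 2"
  unfolding \<theta>3_def \<theta>4_def by (simp add: min_def max_def field_simps)

text \<open>This is the unmerged weight: out of a total \<open>1 / c\<close> with
  \<open>c = cc R\<close>, keeping \<open>u\<close> and halving the rest leaves
  \<open>(u + 1 / c) / 2\<close>, which equals \<open>R\<close> for this \<open>u\<close>.\<close>

lemma \<theta>13_sum: "\<theta>1 R l + \<theta>3 R l = 2 * R - 1 / real (cc R)"
  unfolding \<theta>1_def \<theta>3_alt by (simp add: min_def max_def)

context
  fixes R l :: real
  assumes R: "0 < R" "R \<le> 1" and l: "2 \<le> l"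
begin

lemma node_wt_nonneg:
  assumes "i < 4" shows "0 \<le> node_wt R l i"
proof -
  have c: "0 < real (cc R)" by (auto simp: cc_def)
  \<comment> \<open>The lower bound on \<open>R\<close> makes \<open>2 * R - 1 / cc R\<close>
    positive; the upper bound does the same job for \<open>\<theta>4\<close>.\<close>
  have "0 \<le> \<theta>1 R l" using cc_bounds[OF R] R12_range[of l] c 
    by (simp add: \<theta>1_def divide_simps)
  moreover have "0 \<le> \<theta>4 R l" using cc_bounds[OF R] R12_range[of l] c
    by (simp add: \<theta>4_def)
  moreover have "0 \<le> \<theta>2 R l" "0 \<le> \<theta>3 R l" by (simp_all add: \<theta>2_def \<theta>3_def)
  moreover have "i = 0 \<or> i = 1 \<or> i = 2 \<or> i = 3" using assms by linarith
  ultimately show ?thesis by (auto simp: node_wt_def numeral_3_eq_3)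
qed

lemma node_deg_ge:
  assumes "i < 4" shows "r1 l \<le> node_deg R l i"
proof -
  have c: "1 \<le> cc R" by (auto simp: cc_def)
  have "r1 l \<le> r2 l" unfolding r1_def r2_def by (intro nat_mono) linarith
  moreover have "r1 l \<le> r1 l * cc R" "r2 l \<le> r2 l * cc R" using c by auto
  ultimately have "r1 l \<le> r1 l * cc R" "r1 l \<le> r2 l * cc R" by linarith+
  moreover have "i = 0 \<or> i = 1 \<or> i = 2 \<or> i = 3" using assms by linarith
  ultimately show ?thesis by (auto simp: node_deg_def numeral_3_eq_3)
qed

lemma node_deg_ge_2: "i < 4 \<Longrightarrow> 2 \<le> node_deg R l i"
  using node_deg_ge r12_ge[of 2 l] l by fastforce

lemma node_wt_sum: "(\<Sum>i<4. node_wt R l i) = R"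
proof -
  have "R1 l / real (cc R) + R2 l / real (cc R) = 1 / real (cc R)"
    using R12_range(5)[of l] by (simp add: add_divide_distrib[symmetric])
  then show ?thesis
    unfolding sum_four node_wt_def using \<theta>13_sum[of R l]
    by (simp add: \<theta>2_alt \<theta>4_alt numeral_3_eq_3 diff_divide_distrib)
qed

text \<open>Merging two nodes preserves their edges, so the products of weight and degree add up as
  they would without merging.\<close>

lemma edge_sum: "(\<Sum>i<4. node_wt R l i * real (node_deg R l i)) = l"
proof -
  have c: "0 < real (cc R)" by (auto simp: cc_def)
  have "(\<Sum>i<4. node_wt R l i * real (node_deg R l i)) = R1 l * real (r1 l) + R2 l * real (r2 l)"
    unfolding sum_four node_wt_def node_deg_def
    using c by (simp add: \<theta>2_alt \<theta>4_alt numeral_3_eq_3) (simp add: field_simps)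
  then show ?thesis using R12_mean[of l] l by simp
qed

lemma P_formula_sum:
  "P_formula R l \<xi> \<tau> = - l * entropy_e (\<xi> / l) - \<xi> * ln \<tau>
     + (\<Sum>i<4. node_wt R l i * ln (g \<tau> (node_deg R l i) / 2))"
  unfolding sum_four by (simp add: P_formula_def node_wt_def node_deg_def numeral_3_eq_3)

lemma saddle_lhs_sum:
  "saddle_lhs R l \<tau> = (\<Sum>i<4. node_wt R l i * real (node_deg R l i) *
     (g \<tau> (node_deg R l i - 1) / g \<tau> (node_deg R l i)))"
  unfolding sum_four
  by (simp add: saddle_lhs_def node_wt_def node_deg_def numeral_3_eq_3 Let_def mult_ac
      del: One_nat_def)

section \<open>Monotonicity and range of the saddle-point equation\<close>

lemma edge_wt_pos: "\<exists>i<4. 0 < node_wt R l i * real (node_deg R l i)"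
proof (rule ccontr)
  assume "\<not> ?thesis"
  then have "(\<Sum>i<4. node_wt R l i * real (node_deg R l i)) \<le> 0"
    by (intro sum_nonpos) (metis lessThan_iff not_less)
  then show False using edge_sum l by simp
qed

lemma saddle_lhs_strict_antimono:
  assumes "0 \<le> s" "s < t" "t \<le> 1"
  shows "saddle_lhs R l t < saddle_lhs R l s"
  unfolding saddle_lhs_sum
proof (rule sum_strict_mono_ex1)
  show "\<forall>i\<in>{..<4}. node_wt R l i * real (node_deg R l i) *
       (g t (node_deg R l i - 1) / g t (node_deg R l i))
       \<le> node_wt R l i * real (node_deg R l i) *
       (g s (node_deg R l i - 1) / g s (node_deg R l i))"
    using node_wt_nonneg node_deg_ge_2 g_ratio_strict_antimono[OF assms]
    by (intro ballI mult_left_mono) (auto intro: less_imp_le)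
  \<comment> \<open>One class of positive weight suffices for strictness of the sum.\<close>
  obtain i where "i < 4" "0 < node_wt R l i * real (node_deg R l i)" using edge_wt_pos by blast
  then show "\<exists>i\<in>{..<4}. node_wt R l i * real (node_deg R l i) *
       (g t (node_deg R l i - 1) / g t (node_deg R l i))
       < node_wt R l i * real (node_deg R l i) *
       (g s (node_deg R l i - 1) / g s (node_deg R l i))"
    using node_deg_ge_2 g_ratio_strict_antimono[OF assms]
    by (intro bexI[of _ i] mult_strict_left_mono) auto
qed simp

text \<open>With \<open>saddle_lhs_1\<close> this brackets the target \<open>l - \<xi>\<close> for
  \<open>0 < \<xi> < l / 2\<close>, as the intermediate value theorem requires.\<close>

lemma saddle_lhs_0: "saddle_lhs R l 0 = l"
proof -
  have "saddle_lhs R l 0 = (\<Sum>i<4. node_wt R l i * real (node_deg R l i))"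
    unfolding saddle_lhs_sum by (intro sum.cong) (auto simp: g_def)
  then show ?thesis using edge_sum by simp
qed

lemma saddle_lhs_1: "saddle_lhs R l 1 = l / 2"
proof -
  \<comment> \<open>Degree 1 would give the ratio 1, because \<open>0 ^ 0 = 1\<close>.\<close>
  have "g 1 (d - 1) / g 1 d = 1 / 2" if d: "2 \<le> d" for d
  proof -
    obtain m where "d = Suc (Suc m)" using d nat_le_iff_add[of 2 d] by auto
    then show ?thesis by (simp add: g_def)
  qed
  then have "saddle_lhs R l 1 = (\<Sum>i<4. node_wt R l i * real (node_deg R l i) * (1 / 2))"
    unfolding saddle_lhs_sum by (intro sum.cong refl) (simp only: lessThan_iff node_deg_ge_2)
  also have "\<dots> = l / 2" unfolding sum_distrib_right[symmetric] edge_sum by simp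
  finally show ?thesis .
qed

lemma saddle_lhs_gt_1:
  assumes "1 < \<tau>" shows "saddle_lhs R l \<tau> \<le> l / 2"
proof -
  have "saddle_lhs R l \<tau> \<le> (\<Sum>i<4. node_wt R l i * real (node_deg R l i) * (1 / 2))"
    unfolding saddle_lhs_sum
    using g_ratio_less_half[OF assms] node_deg_ge_2 node_wt_nonneg
    by (intro sum_mono mult_left_mono) (auto intro: less_imp_le)
  also have "\<dots> = l / 2" unfolding sum_distrib_right[symmetric] edge_sum by simp
  finally show ?thesis .
qed

lemma saddle_lhs_continuous: "continuous_on {0..1} (saddle_lhs R l)"
proof -
  have "continuous_on {0..1} (\<lambda>\<tau>. g \<tau> d)" for d
    unfolding g_def by (intro continuous_intros)
  moreover have "\<forall>\<tau>\<in>{0..1}. g \<tau> d \<noteq> 0" for d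
    using g_pos by (metis atLeastAtMost_iff less_irrefl)
  ultimately show ?thesis unfolding saddle_lhs_sum[abs_def]
    by (intro continuous_intros) 
qed

end

subsection \<open>The exponent as a minimum\<close>

lemma g_deriv:
  "((\<lambda>\<tau>. g \<tau> d) has_real_derivative real d * (1 + \<tau>) ^ (d - 1) - real d * (1 - \<tau>) ^ (d - 1)) (at \<tau>)"
  unfolding g_def by (auto intro!: derivative_eq_intros)

text \<open>Multiplying the derivative of \<open>g\<close> by \<tau> gives
  \<open>d * (g \<tau> d - g \<tau> (d - 1))\<close>, which produces the ratio occurring in
  \<open>saddle_lhs\<close>.\<close>

lemma ln_g_deriv:
  assumes "0 < \<tau>"
  shows "((\<lambda>\<tau>. ln (g \<tau> d / 2)) has_real_derivative real d * (1 - g \<tau> (d - 1) / g \<tau> d) / \<tau>) (at \<tau>)"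
proof -
  have pos: "0 < g \<tau> d" using assms by (simp add: g_pos)
  have "\<tau> * (real d * (1 + \<tau>) ^ (d - 1) - real d * (1 - \<tau>) ^ (d - 1)) = real d * (g \<tau> d - g \<tau> (d - 1))"
    by (cases d) (simp_all add: g_def algebra_simps)
  then have eq: "real d * (1 + \<tau>) ^ (d - 1) - real d * (1 - \<tau>) ^ (d - 1)
     = real d * (g \<tau> d - g \<tau> (d - 1)) / \<tau>" using assms by (simp add: field_simps)
  have "((\<lambda>\<tau>. ln (g \<tau> d / 2)) has_real_derivative
     1 / (g \<tau> d / 2) * ((real d * (1 + \<tau>) ^ (d - 1) - real d * (1 - \<tau>) ^ (d - 1)) / 2)) (at \<tau>)"
    using pos by (intro DERIV_chain'[OF _ DERIV_ln_divide] DERIV_cdivide g_deriv) auto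
  then show ?thesis unfolding eq by (rule DERIV_cong) (use assms pos in \<open>simp add: field_simps\<close>)
qed

section \<open>Splitting the exponent into a divergence and a check-node part\<close>

definition base_exponent :: "real \<Rightarrow> real \<Rightarrow> real \<Rightarrow> real" where
  "base_exponent l \<xi> \<tau> = - l * entropy_e (\<xi> / l) - \<xi> * ln \<tau> + l * ln (1 + \<tau>)"

definition node_exponent :: "real \<Rightarrow> real \<Rightarrow> real \<Rightarrow> real" where
  "node_exponent R l x = (\<Sum>i<4. node_wt R l i * ln ((1 + x ^ node_deg R l i) / 2))"

text \<open>\<open>base_exponent\<close> is \<open>l\<close> times the Kullback-Leibler divergence
  of the Bernoulli law with parameter \<open>\<xi> / l\<close> from the one with parameter
  \<open>\<tau> / (1 + \<tau>)\<close>. Nonnegativity follows from \<open>ln x \<le> x - 1\<close>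
  at both likelihood ratios.\<close>

lemma base_exponent_nonneg:
  assumes "0 < \<xi>" "\<xi> < l" "0 < \<tau>"
  shows "0 \<le> base_exponent l \<xi> \<tau>"
proof -
  define p where "p = \<xi> / l"
  have p: "0 < p" "p < 1" using assms by (auto simp: p_def)
  have l: "l > 0" using assms by simp
  have 1: "ln (\<tau> / (p * (1 + \<tau>))) \<le> \<tau> / (p * (1 + \<tau>)) - 1"
    using p assms by (intro ln_le_minus_one) simp
  have 2: "ln (1 / ((1 - p) * (1 + \<tau>))) \<le> 1 / ((1 - p) * (1 + \<tau>)) - 1"
    using p assms by (intro ln_le_minus_one) simp
  have "p * ln (\<tau> / (p * (1 + \<tau>))) + (1 - p) * ln (1 / ((1 - p) * (1 + \<tau>)))
     \<le> p * (\<tau> / (p * (1 + \<tau>)) - 1) + (1 - p) * (1 / ((1 - p) * (1 + \<tau>)) - 1)"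
    using 1 2 p by (intro add_mono mult_left_mono) auto
  also have "\<dots> = (\<tau> / (1 + \<tau>) - p) + (1 / (1 + \<tau>) - (1 - p))"
  proof -
    have "q * (a / (q * b) - 1) = a / b - q" if "q \<noteq> 0" for a b q :: real
      using that by (simp add: right_diff_distrib)
    then show ?thesis using p by simp
  qed
  also have "\<dots> = 0" using assms by (simp add: divide_simps) (simp add: algebra_simps)
  also have "p * ln (\<tau> / (p * (1 + \<tau>))) + (1 - p) * ln (1 / ((1 - p) * (1 + \<tau>)))
     = entropy_e p + p * ln \<tau> - ln (1 + \<tau>)"
  proof -
    have "ln (\<tau> / (q * (1 + \<tau>))) = ln \<tau> - ln q - ln (1 + \<tau>)"
      "ln (1 / (q * (1 + \<tau>))) = - ln q - ln (1 + \<tau>)" if "0 < q" for q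
      using that assms by (simp_all add: ln_div ln_mult del: distrib_left_numeral)
    then show ?thesis using p by (simp add: entropy_e_def) (simp add: algebra_simps)
  qed
  finally have "0 \<le> l * (ln (1 + \<tau>) - p * ln \<tau> - entropy_e p)"
    using l by (intro mult_nonneg_nonneg) auto
  also have "\<dots> = base_exponent l \<xi> \<tau>"
    unfolding base_exponent_def p_def[symmetric] using l by (simp add: p_def algebra_simps)
  finally show ?thesis .
qed

text \<open>At this \<tau> the two Bernoulli parameters coincide.\<close>

lemma base_exponent_zero:
  assumes "0 < \<xi>" "\<xi> < l"
  shows "base_exponent l \<xi> (\<xi> / (l - \<xi>)) = 0"
proof -
  have "1 + \<xi> / (l - \<xi>) = l / (l - \<xi>)" "1 - \<xi> / l = (l - \<xi>) / l"
    using assms by (simp_all add: field_simps)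
  then show ?thesis
    unfolding base_exponent_def entropy_e_def using assms
    by (simp add: ln_div field_simps)
qed

text \<open>For \<open>y = x ^ d\<close> this is the change of the exponent when merged nodes are
  split again: one unit of weight at degree \<open>d\<close> replaces half a unit at degree
  \<open>2 * d\<close>. The bounds come from
  \<open>1 + y^2 \<le> (1 + y)^2 < 2 * (1 + y^2)\<close>.\<close>

lemma ln_half_pair_bounds:
  fixes y :: real
  assumes "0 \<le> y" "y < 1"
  shows "- ln 2 / 2 \<le> ln ((1 + y) / 2) - ln ((1 + y\<^sup>2) / 2) / 2"
    and "ln ((1 + y) / 2) - ln ((1 + y\<^sup>2) / 2) / 2 < 0"
proof -
  have pos: "0 < 1 + y" "0 < 1 + y\<^sup>2" using assms by (auto intro: add_pos_nonneg)
  have eq: "ln ((1 + y) / 2) - ln ((1 + y\<^sup>2) / 2) / 2 = (ln ((1 + y)\<^sup>2) - ln (2 * (1 + y\<^sup>2))) / 2"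
    using pos by (simp add: ln_div ln_mult[of 2] ln_realpow del: distrib_left_numeral) (simp add: field_simps)
  have "(1 + y)\<^sup>2 < 2 * (1 + y\<^sup>2)"
  proof -
    have "0 < (1 - y)\<^sup>2" using assms by simp
    then show ?thesis by (simp add: power2_eq_square algebra_simps)
  qed
  then have "ln ((1 + y)\<^sup>2) < ln (2 * (1 + y\<^sup>2))" using pos by simp
  then show "ln ((1 + y) / 2) - ln ((1 + y\<^sup>2) / 2) / 2 < 0" unfolding eq by simp
  have "1 + y\<^sup>2 \<le> (1 + y)\<^sup>2" using assms by (simp add: power2_eq_square algebra_simps)
  then have "ln (1 + y\<^sup>2) \<le> ln ((1 + y)\<^sup>2)" using pos by simp
  then show "- ln 2 / 2 \<le> ln ((1 + y) / 2) - ln ((1 + y\<^sup>2) / 2) / 2"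
    unfolding eq using pos by (simp add: ln_mult del: distrib_left_numeral)
qed

text \<open>
  On the closed interval between two consecutive powers of two the dependence on \<open>R\<close> is through a
  \<open>min\<close> and a \<open>max\<close> only. At the left endpoint \<open>cc R\<close> is \<open>2 * c\<close> instead of \<open>c\<close>, but the same formula
  holds; this makes the exponent continuous in \<open>R\<close> although \<open>cc\<close> jumps.
\<close>

lemma node_exponent_block:
  fixes R l x :: real and m :: nat
  defines "c \<equiv> (2::nat) ^ m"
  assumes "1 / (2 * real c) \<le> R" "R \<le> 1 / real c"
  defines "\<alpha> \<equiv> \<lambda>d. ln ((1 + x ^ (d * c)) / 2)" and "\<beta> \<equiv> \<lambda>d. ln ((1 + x ^ (2 * d * c)) / 2)"
  shows "node_exponent R l x = (R1 l * \<beta> (r1 l) + R2 l * \<beta> (r2 l)) / (2 * real c)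
     + min (2 * R - 1 / real c) (R1 l / real c) * (\<alpha> (r1 l) - \<beta> (r1 l) / 2)
     + max (2 * R - 1 / real c - R1 l / real c) 0 * (\<alpha> (r2 l) - \<beta> (r2 l) / 2)"
proof (cases "R = 1 / (2 * real c)")
  case True
  have "cc R = 2 ^ Suc m" using True by (intro cc_unique) (simp_all add: c_def divide_simps)
  then have cc: "cc R = 2 * c" by (simp add: c_def)
  have c: "0 < real c" by (simp add: c_def)
  have "\<theta>1 R l = R1 l / (2 * real c)"
    unfolding \<theta>1_def cc unfolding True using R12_range[of l] c by (simp add: min_def field_simps)
  moreover have "\<theta>3 R l = R2 l / (2 * real c)"
  proof -
    have R1: "R1 l = 1 - R2 l" using R12_range(5)[of l] by simp
    show ?thesis
      unfolding \<theta>3_alt cc unfolding True R1 using R12_range[of l] c by (simp add: max_def field_simps)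
  qed
  moreover have "min (2 * R - 1 / real c) (R1 l / real c) = 0"
    "max (2 * R - 1 / real c - R1 l / real c) 0 = 0"
    unfolding True using R12_range[of l] c by simp_all
  ultimately show ?thesis
    unfolding node_exponent_def sum_four node_wt_def node_deg_def \<alpha>_def \<beta>_def
    by (simp add: \<theta>2_alt \<theta>4_alt cc numeral_3_eq_3 mult_ac add_divide_distrib)
next
  case False
  then have "cc R = c" using assms(2,3) unfolding c_def by (intro cc_unique) auto
  then show ?thesis
    unfolding node_exponent_def sum_four node_wt_def node_deg_def \<alpha>_def \<beta>_def
    by (simp add: \<theta>2_alt \<theta>4_alt numeral_3_eq_3 \<theta>1_def[symmetric] \<theta>3_alt[symmetric])
       (simp add: \<theta>1_def \<theta>3_alt diff_divide_distrib add_divide_distrib algebra_simps)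
qed

section \<open>Dependence of the exponent on the rate \<open>R\<close>\<close>

definition drop_bounds :: "real \<Rightarrow> real \<Rightarrow> bool" where
  "drop_bounds d e \<longleftrightarrow> 0 < d \<and> d \<le> ln 2 * e"

text \<open>Strict decrease and the Lipschitz bound share one predicate because both add up over
  adjacent intervals.\<close>

lemma drop_bounds_add: "drop_bounds d e \<Longrightarrow> drop_bounds d' e' \<Longrightarrow> drop_bounds (d + d') (e + e')"
  by (auto simp: drop_bounds_def algebra_simps)

text \<open>Within a dyadic block \<open>u\<close> and \<open>v\<close> are nondecreasing and
  together grow by twice the increase of \<open>R\<close>, while their coefficients are negative and
  at least \<open>- ln 2 / 2\<close>.\<close>

lemma node_exponent_drop_block:
  assumes "0 \<le> x" "x < 1" "1 \<le> l"
    and "1 / (2 * 2 ^ m) \<le> R" "R < R'" "R' \<le> 1 / 2 ^ m"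
  shows "drop_bounds (node_exponent R l x - node_exponent R' l x) (R' - R)"
proof -
  define c where "c = (2::nat) ^ m"
  define \<alpha> where "\<alpha> = (\<lambda>d. ln ((1 + x ^ (d * c)) / 2))"
  define \<beta> where "\<beta> = (\<lambda>d. ln ((1 + x ^ (2 * d * c)) / 2))"
  define u where "u = (\<lambda>R. min (2 * R - 1 / real c) (R1 l / real c))"
  define v where "v = (\<lambda>R. max (2 * R - 1 / real c - R1 l / real c) 0)"
  have block: "node_exponent R l x = (R1 l * \<beta> (r1 l) + R2 l * \<beta> (r2 l)) / (2 * real c)
     + u R * (\<alpha> (r1 l) - \<beta> (r1 l) / 2) + v R * (\<alpha> (r2 l) - \<beta> (r2 l) / 2)"
    if "1 / (2 * real c) \<le> R" "R \<le> 1 / real c" for R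
    using node_exponent_block[of m R l x] that
    unfolding u_def v_def \<alpha>_def \<beta>_def c_def by simp
  have coeff: "- ln 2 / 2 \<le> \<alpha> d - \<beta> d / 2 \<and> \<alpha> d - \<beta> d / 2 < 0" if "1 \<le> d" for d
  proof -
    have "0 < d * c" using that by (simp add: c_def)
    then have "0 \<le> x ^ (d * c)" "x ^ (d * c) < 1"
      using assms by (auto intro: power_less_one_iff[THEN iffD2])
    moreover have "x ^ (2 * d * c) = (x ^ (d * c))\<^sup>2" by (simp add: power_mult[symmetric] mult_ac)
    ultimately show ?thesis using ln_half_pair_bounds[of "x ^ (d * c)"]
      unfolding \<alpha>_def \<beta>_def by simp
  qed
  have d: "1 \<le> r1 l" "1 \<le> r2 l" using r12_ge[of 1 l] assms by auto
  define A where "A = \<alpha> (r1 l) - \<beta> (r1 l) / 2"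
  define B where "B = \<alpha> (r2 l) - \<beta> (r2 l) / 2"
  have A: "0 < - A" "- A \<le> ln 2 / 2" using coeff[OF d(1)] by (auto simp: A_def)
  have B: "0 < - B" "- B \<le> ln 2 / 2" using coeff[OF d(2)] by (auto simp: B_def)
  have uv: "0 \<le> u R' - u R" "0 \<le> v R' - v R" "(u R' - u R) + (v R' - v R) = 2 * (R' - R)"
    using assms(5) unfolding u_def v_def by (auto simp: min_def max_def)
  have eq: "node_exponent R l x - node_exponent R' l x = (u R' - u R) * (- A) + (v R' - v R) * (- B)"
    using block[of R] block[of R'] assms unfolding A_def[symmetric] B_def[symmetric]
    by (simp add: c_def algebra_simps)
  have "0 < u R' - u R \<or> 0 < v R' - v R" using uv assms(5)
    by (cases "0 < u R' - u R") auto
  then have "0 < (u R' - u R) * (- A) + (v R' - v R) * (- B)"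
    using A B uv by (metis add_nonneg_pos add_pos_nonneg less_imp_le mult_nonneg_nonneg mult_pos_pos)
  moreover have "(u R' - u R) * (- A) + (v R' - v R) * (- B)
     \<le> (u R' - u R) * (ln 2 / 2) + (v R' - v R) * (ln 2 / 2)"
    using A B uv by (intro add_mono mult_left_mono) auto
  moreover have "\<dots> = ln 2 * (R' - R)"
    using uv(3) by (metis (no_types, opaque_lifting) distrib_right mult.commute mult.assoc
        nonzero_mult_div_cancel_left times_divide_eq_right zero_neq_numeral)
  ultimately show ?thesis unfolding drop_bounds_def eq by simp
qed

text \<open>Induction on the number of dyadic blocks below 1: an interval that crosses
  \<open>1 / 2 ^ m\<close> is cut there and the two drops add. The case \<open>m = 0\<close> is
  vacuous.\<close>

lemma node_exponent_drop:
  assumes "0 \<le> x" "x < 1" "1 \<le> l" "0 < R" "R < R'" "R' \<le> 1"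
  shows "drop_bounds (node_exponent R l x - node_exponent R' l x) (R' - R)"
proof -
  have "drop_bounds (node_exponent R l x - node_exponent R' l x) (R' - R)"
    if "1 / 2 ^ m \<le> R" "R < R'" "R' \<le> 1" for m and R R' :: real
    using that
  proof (induction m arbitrary: R R')
    case (Suc m)
    consider "1 / 2 ^ m \<le> R" | "R' \<le> 1 / 2 ^ m" | "R < 1 / 2 ^ m" "1 / 2 ^ m < R'" by linarith
    then show ?case
    proof cases
      case 1
      then show ?thesis using Suc by blast
    next
      case 2
      then show ?thesis using Suc.prems assms by (intro node_exponent_drop_block[of _ _ m]) auto
    next
      case 3
      have "drop_bounds (node_exponent R l x - node_exponent (1 / 2 ^ m) l x) (1 / 2 ^ m - R)"
        using Suc.prems assms 3 by (intro node_exponent_drop_block[of _ _ m]) auto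
      moreover have "drop_bounds (node_exponent (1 / 2 ^ m) l x - node_exponent R' l x) (R' - 1 / 2 ^ m)"
        using Suc.prems 3 by (intro Suc.IH) auto
      ultimately show ?thesis using drop_bounds_add by fastforce
    qed
  qed simp
  moreover obtain m where "(1 / 2) ^ m < R" using real_arch_pow_inv[of R "1/2"] assms by auto
  ultimately show ?thesis using assms by (metis less_imp_le power_one_over)
qed

text \<open>Each \<open>g\<close> contributes a factor \<open>(1 + \<tau>) ^ d\<close>; by
  \<open>edge_sum\<close> their weighted logarithms add up to
  \<open>l * ln (1 + \<tau>)\<close>.\<close>

lemma P_formula_mob:
  assumes "0 < R" "R \<le> 1" "2 \<le> l" "0 \<le> \<tau>" "\<tau> \<le> 1"
  shows "P_formula R l \<xi> \<tau> = base_exponent l \<xi> \<tau> + node_exponent R l (mob \<tau>)"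
proof -
  have "ln (g \<tau> d / 2) = real d * ln (1 + \<tau>) + ln ((1 + mob \<tau> ^ d) / 2)" for d
  proof -
    have "0 < (1 + mob \<tau> ^ d) / 2" using mob_range assms by (simp add: add_pos_nonneg)
    then show ?thesis using assms ln_mult[of "(1 + \<tau>) ^ d" "(1 + mob \<tau> ^ d) / 2"]
      by (simp add: g_eq_mob ln_realpow)
  qed
  then have "(\<Sum>i<4. node_wt R l i * ln (g \<tau> (node_deg R l i) / 2))
    = (\<Sum>i<4. node_wt R l i * real (node_deg R l i)) * ln (1 + \<tau>) + node_exponent R l (mob \<tau>)"
    by (simp add: node_exponent_def sum.distrib distrib_left sum_distrib_right mult.assoc)
  then show ?thesis
    unfolding P_formula_sum[OF assms(1-3)] edge_sum[OF assms(1-3)] base_exponent_def by simp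
qed

text \<open>\<open>edge_sum\<close> collects the constant parts of the derivatives into
  \<open>l\<close>, so the slope has the sign of
  \<open>l - \<xi> - saddle_lhs R l \<tau>\<close>.\<close>

lemma P_formula_deriv:
  assumes "0 < R" "R \<le> 1" "2 \<le> l" "0 < \<tau>"
  shows "(P_formula R l \<xi> has_real_derivative (l - \<xi> - saddle_lhs R l \<tau>) / \<tau>) (at \<tau>)"
proof -
  have "((\<lambda>\<tau>. \<Sum>i<4. node_wt R l i * ln (g \<tau> (node_deg R l i) / 2)) has_real_derivative
     (\<Sum>i<4. node_wt R l i * (real (node_deg R l i) *
        (1 - g \<tau> (node_deg R l i - 1) / g \<tau> (node_deg R l i)) / \<tau>))) (at \<tau>)"
    by (intro DERIV_sum DERIV_cmult ln_g_deriv assms)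
  moreover have "(\<Sum>i<4. node_wt R l i * (real (node_deg R l i) *
        (1 - g \<tau> (node_deg R l i - 1) / g \<tau> (node_deg R l i)) / \<tau>))
      = (l - saddle_lhs R l \<tau>) / \<tau>"
  proof -
    have "l - saddle_lhs R l \<tau> = (\<Sum>i<4. node_wt R l i * real (node_deg R l i) *
        (1 - g \<tau> (node_deg R l i - 1) / g \<tau> (node_deg R l i)))"
      unfolding right_diff_distrib sum_subtractf saddle_lhs_sum[OF assms(1-3)]
      by (simp only: mult_1_right edge_sum[OF assms(1-3)])
    then show ?thesis by (simp only: sum_divide_distrib mult.assoc times_divide_eq_right)
  qed
  ultimately have *: "((\<lambda>\<tau>. \<Sum>i<4. node_wt R l i * ln (g \<tau> (node_deg R l i) / 2)) has_real_derivative
     (l - saddle_lhs R l \<tau>) / \<tau>) (at \<tau>)" by simp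
  have "((\<lambda>\<tau>. (- l * entropy_e (\<xi> / l) - \<xi> * ln \<tau>)
     + (\<Sum>i<4. node_wt R l i * ln (g \<tau> (node_deg R l i) / 2))) has_real_derivative
     (0 - \<xi> * (1 / \<tau>)) + (l - saddle_lhs R l \<tau>) / \<tau>) (at \<tau>)"
    using assms by (intro DERIV_add[OF _ *] DERIV_diff DERIV_const DERIV_cmult DERIV_ln_divide)
  then show ?thesis
    unfolding P_formula_sum[OF assms(1-3), abs_def]
    by (rule DERIV_cong) (use assms in \<open>simp add: field_simps\<close>)
qed

section \<open>The saddle point as minimizer and the resulting bounds\<close>

definition P_real :: "real \<Rightarrow> real \<Rightarrow> real \<Rightarrow> real" where
  "P_real R l \<xi> = P_formula R l \<xi> (saddle_point R l \<xi>)"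

context
  fixes R l \<xi> :: real
  assumes R: "0 < R" "R \<le> 1" and l: "2 \<le> l" and \<xi>: "0 < \<xi>" "\<xi> < l / 2"
begin

text \<open>Existence comes from the intermediate value theorem on \<open>{0..1}\<close>, uniqueness
  there from strict decrease; a root above 1 is impossible because \<open>saddle_lhs\<close> is at
  most \<open>l / 2 < l - \<xi>\<close>.\<close>

lemma saddle_point_bounds:
  "0 < saddle_point R l \<xi>" "saddle_point R l \<xi> < 1"
  "saddle_lhs R l (saddle_point R l \<xi>) = l - \<xi>"
proof -
  have "\<exists>\<tau>\<ge>0. \<tau> \<le> 1 \<and> saddle_lhs R l \<tau> = l - \<xi>"
    using saddle_lhs_0[OF R l] saddle_lhs_1[OF R l] \<xi>
    by (intro IVT2' saddle_lhs_continuous[OF R l]) auto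
  then obtain \<tau> where \<tau>: "0 \<le> \<tau>" "\<tau> \<le> 1" "saddle_lhs R l \<tau> = l - \<xi>" by blast
  then have "\<tau> \<noteq> 0" "\<tau> \<noteq> 1"
    using saddle_lhs_0[OF R l] saddle_lhs_1[OF R l] \<xi> by auto
  moreover have "saddle_point R l \<xi> = \<tau>"
    unfolding saddle_point_def
  proof (rule the_equality)
    fix s assume s: "0 \<le> s \<and> saddle_lhs R l s = l - \<xi>"
    then have "s \<le> 1" using saddle_lhs_gt_1[OF R l, of s] \<xi> by force
    then show "s = \<tau>"
      using s \<tau> saddle_lhs_strict_antimono[OF R l, of s \<tau>] saddle_lhs_strict_antimono[OF R l, of \<tau> s]
      by (cases s \<tau> rule: linorder_cases) auto
  qed (use \<tau> in auto)
  ultimately show "0 < saddle_point R l \<xi>" "saddle_point R l \<xi> < 1"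
    "saddle_lhs R l (saddle_point R l \<xi>) = l - \<xi>" using \<tau> by auto
qed

text \<open>\<open>saddle_lhs\<close> is decreasing, hence the slope of \<open>P_formula\<close> is
  nonpositive before the saddle point and nonnegative after it.\<close>

lemma P_real_le:
  assumes s: "0 < s" "s \<le> 1"
  shows "P_real R l \<xi> \<le> P_formula R l \<xi> s"
proof -
  define t where "t = saddle_point R l \<xi>"
  have t: "0 < t" "t < 1" "saddle_lhs R l t = l - \<xi>"
    using saddle_point_bounds by (auto simp: t_def)
  show ?thesis unfolding P_real_def t_def[symmetric]
  proof (cases "t \<le> s")
    case True
    then show "P_formula R l \<xi> t \<le> P_formula R l \<xi> s"
    proof (rule DERIV_nonneg_imp_nondecreasing)
      fix u assume u: "t \<le> u" "u \<le> s"
      then have "saddle_lhs R l u \<le> l - \<xi>"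
        using saddle_lhs_strict_antimono[OF R l, of t u] t s by (cases "t = u") auto
      then show "\<exists>y. (P_formula R l \<xi> has_real_derivative y) (at u) \<and> 0 \<le> y"
        using P_formula_deriv[OF R l, of u \<xi>] t u by (intro exI conjI) auto
    qed
  next
    case False
    then have "s \<le> t" by simp
    then show "P_formula R l \<xi> t \<le> P_formula R l \<xi> s"
    proof (rule DERIV_nonpos_imp_nonincreasing)
      fix u assume u: "s \<le> u" "u \<le> t"
      then have "saddle_lhs R l u \<ge> l - \<xi>"
        using saddle_lhs_strict_antimono[OF R l, of u t] t s by (cases "t = u") auto
      then show "\<exists>y. (P_formula R l \<xi> has_real_derivative y) (at u) \<and> y \<le> 0"
        using P_formula_deriv[OF R l, of u \<xi>] s u
        by (intro exI conjI) (auto simp: divide_nonpos_pos)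
    qed
  qed
qed

text \<open>The parity terms remove at most \<open>\<theta>1 + \<theta>3 \<le> 1\<close> from
  \<open>l\<close>, so \<open>\<xi>max \<ge> l - 1 \<ge> l / 2 > \<xi>\<close> and the first branch
  of \<open>P\<close> applies.\<close>

lemma P_eq_P_real: "P R l \<xi> = ereal (P_real R l \<xi>)"
proof -
  have c: "1 \<le> real (cc R)" by (simp add: cc_def)
  have "0 \<le> \<theta>1 R l" "0 \<le> \<theta>3 R l"
    using node_wt_nonneg[OF R l, of 0] node_wt_nonneg[OF R l, of 2] by (auto simp: node_wt_def)
  moreover have "\<theta>1 R l + \<theta>3 R l \<le> 1 / real (cc R)"
    using cc_bounds[OF R] by (simp add: \<theta>13_sum)
  moreover have "1 / real (cc R) \<le> 1" using c by simp
  ultimately have "\<xi>max R l \<ge> l - 1" unfolding \<xi>max_def par_def by auto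
  then have "\<xi> < \<xi>max R l" using l \<xi> by linarith
  then show ?thesis using \<xi> by (simp add: P_def P_real_def)
qed

lemma node_exponent_ge:
  assumes "0 \<le> x" shows "- R * ln 2 \<le> node_exponent R l x"
proof -
  have "(\<Sum>i<4. node_wt R l i * (- ln 2)) \<le> node_exponent R l x"
    unfolding node_exponent_def
  proof (intro sum_mono mult_left_mono)
    fix i assume "i \<in> {..<4::nat}"
    then show "0 \<le> node_wt R l i" using node_wt_nonneg[OF R l] by simp
    have "ln (1 / 2) \<le> ln ((1 + x ^ node_deg R l i) / 2)"
      using assms by (subst ln_le_cancel_iff) (auto intro: add_pos_nonneg)
    then show "- ln 2 \<le> ln ((1 + x ^ node_deg R l i) / 2)" by (simp add: ln_div)
  qed
  then show ?thesis unfolding sum_distrib_right[symmetric] node_wt_sum[OF R l] by simp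
qed

text \<open>Uses \<open>ln (1 + y) \<le> y\<close> for each class; as \<open>x \<le> 1\<close> and
  all degrees are at least \<open>r1 l\<close>, each power is at most
  \<open>x ^ r1 l\<close>.\<close>

lemma node_exponent_le:
  assumes "0 \<le> x" "x \<le> 1" shows "node_exponent R l x \<le> R * (x ^ r1 l - ln 2)"
proof -
  have "node_exponent R l x \<le> (\<Sum>i<4. node_wt R l i * (x ^ r1 l - ln 2))"
    unfolding node_exponent_def
  proof (intro sum_mono mult_left_mono)
    fix i assume i: "i \<in> {..<4::nat}"
    then show "0 \<le> node_wt R l i" using node_wt_nonneg[OF R l] by simp
    have "ln (1 + x ^ node_deg R l i) \<le> x ^ node_deg R l i"
      using assms by (intro ln_add_one_self_le_self) auto
    also have "\<dots> \<le> x ^ r1 l" using assms i node_deg_ge[OF R l] by (intro power_decreasing) auto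
    finally have "ln (1 + x ^ node_deg R l i) \<le> x ^ r1 l" .
    moreover have "0 < 1 + x ^ node_deg R l i" using assms by (simp add: add_pos_nonneg)
    ultimately show "ln ((1 + x ^ node_deg R l i) / 2) \<le> x ^ r1 l - ln 2" by (simp add: ln_div)
  qed
  then show ?thesis unfolding sum_distrib_right[symmetric] node_wt_sum[OF R l] by simp
qed

lemma P_real_ge: "- R * ln 2 \<le> P_real R l \<xi>"
proof -
  have "0 \<le> base_exponent l \<xi> (saddle_point R l \<xi>)"
    using saddle_point_bounds \<xi> by (intro base_exponent_nonneg) auto
  moreover have "- R * ln 2 \<le> node_exponent R l (mob (saddle_point R l \<xi>))"
    using saddle_point_bounds mob_range by (intro node_exponent_ge) (auto simp: less_imp_le)
  ultimately show ?thesis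
    unfolding P_real_def using P_formula_mob[OF R l, of "saddle_point R l \<xi>"] saddle_point_bounds
    by simp
qed

lemma P_real_le_node_exponent: "P_real R l \<xi> \<le> node_exponent R l (1 - 2 * \<xi> / l)"
proof -
  have t: "0 < \<xi> / (l - \<xi>)" "\<xi> / (l - \<xi>) \<le> 1" using \<xi> by (auto simp: divide_simps)
  have x: "mob (\<xi> / (l - \<xi>)) = 1 - 2 * \<xi> / l" using \<xi> l by (simp add: mob_def field_simps)
  have "P_real R l \<xi> \<le> P_formula R l \<xi> (\<xi> / (l - \<xi>))" using t by (rule P_real_le)
  also have "\<dots> = node_exponent R l (1 - 2 * \<xi> / l)"
    using P_formula_mob[OF R l, of "\<xi> / (l - \<xi>)"] t base_exponent_zero[of \<xi> l] \<xi> x by simp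
  finally show ?thesis .
qed

lemma P_real_upper: "P_real R l \<xi> \<le> R * ((1 - 2 * \<xi> / l) ^ r1 l - ln 2)"
  using \<xi> l by (intro order_trans[OF P_real_le_node_exponent node_exponent_le]) (auto simp: divide_simps)

lemma P_real_nonpos: "P_real R l \<xi> \<le> 0"
proof -
  have x: "0 \<le> 1 - 2 * \<xi> / l" "1 - 2 * \<xi> / l \<le> 1" using \<xi> l by (auto simp: field_simps)
  have "node_exponent R l (1 - 2 * \<xi> / l) \<le> 0"
    unfolding node_exponent_def
  proof (intro sum_nonpos mult_nonneg_nonpos)
    fix i assume "i \<in> {..<4::nat}"
    then show "0 \<le> node_wt R l i" using node_wt_nonneg[OF R l] by simp
    show "ln ((1 + (1 - 2 * \<xi> / l) ^ node_deg R l i) / 2) \<le> 0"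
      using x by (subst ln_le_zero_iff) (auto intro: power_le_one add_pos_nonneg)
  qed
  then show ?thesis using P_real_le_node_exponent by linarith
qed

end

text \<open>Each minimum is tested at the other's minimizer: the saddle point for \<open>R\<close>
  yields the strict inequality, the one for \<open>R'\<close> the Lipschitz bound.\<close>

lemma P_real_drop:
  assumes "0 < R" "R < R'" "R' \<le> 1" "2 \<le> l" "0 < \<xi>" "\<xi> < l / 2"
  shows "drop_bounds (P_real R l \<xi> - P_real R' l \<xi>) (R' - R)"
proof -
  have val: "drop_bounds (P_formula R l \<xi> t - P_formula R' l \<xi> t) (R' - R)" if "0 < t" "t < 1" for t
    using that assms mob_range[of t] mob_less_one[of t] node_exponent_drop[of "mob t" l R R']
    by (simp add: P_formula_mob)
  have "P_real R l \<xi> \<le> P_formula R l \<xi> (saddle_point R' l \<xi>)"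
    using assms saddle_point_bounds[of R' l \<xi>] by (intro P_real_le) auto
  moreover have "P_real R' l \<xi> \<le> P_formula R' l \<xi> (saddle_point R l \<xi>)"
    using assms saddle_point_bounds[of R l \<xi>] by (intro P_real_le) auto
  moreover have "drop_bounds (P_formula R l \<xi> (saddle_point R l \<xi>) - P_formula R' l \<xi> (saddle_point R l \<xi>)) (R' - R)"
    using assms saddle_point_bounds[of R l \<xi>] by (intro val) auto
  moreover have "drop_bounds (P_formula R l \<xi> (saddle_point R' l \<xi>) - P_formula R' l \<xi> (saddle_point R' l \<xi>)) (R' - R)"
    using assms saddle_point_bounds[of R' l \<xi>] by (intro val) auto
  ultimately show ?thesis unfolding drop_bounds_def P_real_def by linarith
qed

subsection \<open>The design rate and its limit\<close>

text \<open>The value 0 extends \<open>- P_real\<close> continuously to \<open>R = 0\<close>,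
  because \<open>P_real\<close> lies between \<open>- R * ln 2\<close> and 0; the rates then range
  over the compact interval \<open>{0..1}\<close>.\<close>

definition neg_exponent :: "real \<Rightarrow> real \<Rightarrow> real \<Rightarrow> real" where
  "neg_exponent l \<xi> R = (if R \<le> 0 then 0 else - P_real R l \<xi>)"

text \<open>The finite-length correction in the first branch of \<open>R_finite\<close>, apart from
  the term with \<open>\<Delta> / n\<close>; setting \<open>\<Delta> = n\<close> gives the
  correction of the second branch.\<close>

definition overhead :: "nat \<Rightarrow> nat \<Rightarrow> real \<Rightarrow> real" where
  "overhead n \<Delta> l = 3 * of_int \<lceil>l\<rceil> / real \<Delta> * ln (real n * l / 2) + 1 / (2 * real n) * ln (real n * l / 4)"

context
  fixes l \<xi> :: real
  assumes l: "2 \<le> l" and \<xi>: "0 < \<xi>" "\<xi> < l / 2"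
begin

lemma neg_exponent_drop:
  assumes "0 \<le> R" "R < R'" "R' \<le> 1"
  shows "drop_bounds (neg_exponent l \<xi> R' - neg_exponent l \<xi> R) (R' - R)"
proof (cases "R = 0")
  case True
  \<comment> \<open>At \<open>R = 0\<close> strictness is borrowed from the pair
    \<open>R' / 2 < R'\<close>.\<close>
  have "0 < P_real (R' / 2) l \<xi> - P_real R' l \<xi>"
    using P_real_drop[of "R' / 2" R' l \<xi>] True assms l \<xi> by (simp add: drop_bounds_def)
  moreover have "P_real (R' / 2) l \<xi> \<le> 0"
    using True assms l \<xi> by (intro P_real_nonpos) auto
  moreover have "- R' * ln 2 \<le> P_real R' l \<xi>"
    using True assms l \<xi> by (intro P_real_ge) auto
  ultimately show ?thesis
    using True assms by (simp add: drop_bounds_def neg_exponent_def mult.commute)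
next
  case False
  then show ?thesis using P_real_drop[of R R' l \<xi>] assms l \<xi> by (simp add: neg_exponent_def)
qed

lemma neg_exponent_le: "0 \<le> R \<Longrightarrow> R \<le> 1 \<Longrightarrow> neg_exponent l \<xi> R \<le> R * ln 2"
  using P_real_ge[OF _ _ l \<xi>, of R] by (auto simp: neg_exponent_def)

lemma neg_exponent_ge:
  assumes "0 \<le> R" "R \<le> 1"
  shows "R * ln 2 - (1 - 2 * \<xi> / l) ^ r1 l \<le> neg_exponent l \<xi> R"
proof -
  have "0 \<le> (1 - 2 * \<xi> / l) ^ r1 l" using l \<xi> by (simp add: field_simps)
  moreover from this have "R * (1 - 2 * \<xi> / l) ^ r1 l \<le> (1 - 2 * \<xi> / l) ^ r1 l"
    using assms by (intro mult_left_le_one_le)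
  ultimately show ?thesis
    using P_real_upper[OF _ _ l \<xi>, of R] assms
    by (auto simp: neg_exponent_def right_diff_distrib)
qed

lemma neg_exponent_lipschitz: "(ln 2)-lipschitz_on {0..1} (neg_exponent l \<xi>)"
proof (rule lipschitz_onI)
  fix x y :: real assume xy: "x \<in> {0..1}" "y \<in> {0..1}"
  show "dist (neg_exponent l \<xi> x) (neg_exponent l \<xi> y) \<le> ln 2 * dist x y"
    using neg_exponent_drop[of x y] neg_exponent_drop[of y x] xy
    by (cases x y rule: linorder_cases) (auto simp: drop_bounds_def dist_real_def)
qed simp

lemma neg_exponent_continuous: "continuous_on {0..1} (neg_exponent l \<xi>)"
  using neg_exponent_lipschitz by (rule lipschitz_on_continuous_on)

lemma neg_exponent_inj: "inj_on (neg_exponent l \<xi>) {0..1}"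
proof (rule linorder_inj_onI)
  fix x y :: real assume "x < y" "x \<in> {0..1}" "y \<in> {0..1}"
  then show "neg_exponent l \<xi> x \<noteq> neg_exponent l \<xi> y"
    using neg_exponent_drop[of x y] by (auto simp: drop_bounds_def)
qed auto

lemma neg_exponent_surj:
  assumes "0 \<le> y" "y \<le> neg_exponent l \<xi> 1"
  obtains R where "0 \<le> R" "R \<le> 1" "neg_exponent l \<xi> R = y"
proof -
  have "neg_exponent l \<xi> 0 = 0" by (simp add: neg_exponent_def)
  then show ?thesis
    using IVT'[of "neg_exponent l \<xi>" 0 y 1] assms neg_exponent_continuous that by auto
qed

end

section \<open>The rate at finite length and its limit\<close>

context
  fixes L :: "real poly" and \<epsilon> l \<xi> :: real
  assumes l_eq: "avg_degree L = l" and \<xi>_eq: "real (min_degree L) * \<epsilon> = \<xi>"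
    and l: "2 \<le> l" and \<xi>: "0 < \<xi>" "\<xi> < l / 2"
begin

lemma le_\<Gamma>_iff:
  "ereal h \<le> \<Gamma> n \<Delta> L \<epsilon> \<longleftrightarrow> (h + real \<Delta> / real n) * ln 2 + overhead n \<Delta> l \<le> neg_exponent l \<xi> 1"
proof -
  have "P 1 l \<xi> = ereal (- neg_exponent l \<xi> 1)"
    using P_eq_P_real[of 1 l \<xi>] l \<xi> by (simp add: neg_exponent_def)
  then have "\<Gamma> n \<Delta> L \<epsilon> = ereal (1 / ln 2 * (neg_exponent l \<xi> 1 - overhead n \<Delta> l) - real \<Delta> / real n)"
    unfolding \<Gamma>_def Let_def l_eq \<xi>_eq overhead_def by simp
  then show ?thesis by (simp add: field_simps)
qed

lemma R_finite_low:
  assumes y: "y = (h + real \<Delta> / real n) * ln 2 + overhead n \<Delta> l" "0 < y" "y \<le> neg_exponent l \<xi> 1"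
  shows "R_finite n \<Delta> L \<epsilon> h \<in> {0..1}" "neg_exponent l \<xi> (R_finite n \<Delta> L \<epsilon> h) = y"
proof -
  obtain R where R: "0 \<le> R" "R \<le> 1" "neg_exponent l \<xi> R = y"
    using neg_exponent_surj[OF l \<xi>, of y] y by auto
  \<comment> \<open>The added point \<open>S = 0\<close> has value 0, and \<open>y > 0\<close>, so
    the extension introduces no new solution.\<close>
  have eq: "(0 < S \<and> S \<le> 1 \<and> - P S l \<xi> = ereal y) \<longleftrightarrow> S \<in> {0..1} \<and> neg_exponent l \<xi> S = y" for S
    using P_eq_P_real[of S l \<xi>] l \<xi> y(2)
    by (auto simp: neg_exponent_def)
  have "R_finite n \<Delta> L \<epsilon> h = (THE R. 0 < R \<and> R \<le> 1 \<and> - P R l \<xi> = ereal y)"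
    using le_\<Gamma>_iff[of h n \<Delta>] y unfolding R_finite_def Let_def l_eq \<xi>_eq
    by (simp add: overhead_def add.assoc)
  also have "\<dots> = R" unfolding eq
    using R neg_exponent_inj[OF l \<xi>] by (intro the_equality) (auto dest: inj_onD)
  finally show "R_finite n \<Delta> L \<epsilon> h \<in> {0..1}" "neg_exponent l \<xi> (R_finite n \<Delta> L \<epsilon> h) = y"
    using R by auto
qed

lemma R_finite_high:
  assumes "neg_exponent l \<xi> 1 < (h + real \<Delta> / real n) * ln 2 + overhead n \<Delta> l"
  shows "R_finite n \<Delta> L \<epsilon> h = 2 + 1 / ln 2 * (overhead n n l - neg_exponent l \<xi> 1)"
proof -
  have "P 1 l \<xi> = ereal (- neg_exponent l \<xi> 1)"
    using P_eq_P_real[of 1 l \<xi>] l \<xi> by (simp add: neg_exponent_def)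
  then show ?thesis
    using le_\<Gamma>_iff[of h n \<Delta>] assms unfolding R_finite_def Let_def l_eq \<xi>_eq
    by (simp add: overhead_def)
qed

end

text \<open>\<open>\<Delta>\<close> grows like \<open>sqrt n\<close>, so \<open>\<Delta> / n\<close>
  and \<open>ln n / \<Delta>\<close> vanish. Once \<open>n * l > 4\<close> both logarithms in
  \<open>overhead\<close> are nonnegative, and \<open>\<Delta> / n > 0\<close> gives
  strictness.\<close>

lemma admissible_limits:
  assumes "admissible n \<Delta>" "0 < l"
  shows "(\<lambda>j. real (\<Delta> j) / real (n j)) \<longlonglongrightarrow> 0"
    and "(\<lambda>j. overhead (n j) (\<Delta> j) l) \<longlonglongrightarrow> 0"
    and "(\<lambda>j. overhead (n j) (n j) l) \<longlonglongrightarrow> 0"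
    and "\<forall>\<^sub>F j in sequentially. 0 < real (\<Delta> j) / real (n j) * ln 2 + overhead (n j) (\<Delta> j) l"
proof -
  have n: "filterlim (\<lambda>j. real (n j)) at_top sequentially"
    using assms(1) unfolding admissible_def
    by (auto intro: filterlim_compose[OF filterlim_real_sequentially])
  have pos: "0 < real (n j)" "0 < real (\<Delta> j)" for j
  proof -
    obtain m where "n j = 2 ^ m" using assms(1) unfolding admissible_def by blast
    then show "0 < real (n j)" by simp
    show "0 < real (\<Delta> j)" using assms(1) by (simp add: admissible_def)
  qed
  have q: "(\<lambda>j. real (\<Delta> j) / sqrt (real (n j))) \<longlonglongrightarrow> 1"
    using assms(1) unfolding admissible_def by auto
  have "((\<lambda>x::real. 1 / sqrt x) \<longlongrightarrow> 0) at_top" by real_asymp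
  from tendsto_mult[OF q filterlim_compose[OF this n]]
  have "(\<lambda>j. real (\<Delta> j) / sqrt (real (n j)) * (1 / sqrt (real (n j)))) \<longlonglongrightarrow> 0" by simp
  then show "(\<lambda>j. real (\<Delta> j) / real (n j)) \<longlonglongrightarrow> 0" by simp
  have "((\<lambda>x. 1 / (2 * x) * ln (x * l / 4)) \<longlongrightarrow> 0) at_top" using assms(2) by real_asymp
  from filterlim_compose[OF this n]
  have b: "(\<lambda>j. 1 / (2 * real (n j)) * ln (real (n j) * l / 4)) \<longlonglongrightarrow> 0" .
  define a where "a = 3 * real_of_int \<lceil>l\<rceil>"
  have "((\<lambda>x. a * (ln (x * l / 2) / sqrt x)) \<longlongrightarrow> 0) at_top" using assms(2) by real_asymp
  from tendsto_mult[OF filterlim_compose[OF this n] tendsto_inverse[OF q]]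
  have "(\<lambda>j. a * (ln (real (n j) * l / 2) / sqrt (real (n j))) * inverse (real (\<Delta> j) / sqrt (real (n j)))) \<longlonglongrightarrow> 0"
    by simp
  also have "(\<lambda>j. a * (ln (real (n j) * l / 2) / sqrt (real (n j))) * inverse (real (\<Delta> j) / sqrt (real (n j))))
     = (\<lambda>j. a / real (\<Delta> j) * ln (real (n j) * l / 2))"
  proof
    fix j
    have "real (n j) \<noteq> 0" "real (\<Delta> j) \<noteq> 0" using pos[of j] by linarith+
    then show "a * (ln (real (n j) * l / 2) / sqrt (real (n j))) * inverse (real (\<Delta> j) / sqrt (real (n j)))
     = a / real (\<Delta> j) * ln (real (n j) * l / 2)" by simp
  qed
  finally show "(\<lambda>j. overhead (n j) (\<Delta> j) l) \<longlonglongrightarrow> 0"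
    unfolding overhead_def a_def using b by (rule tendsto_add_zero)
  have "((\<lambda>x. a / x * ln (x * l / 2)) \<longlongrightarrow> 0) at_top" using assms(2) by real_asymp
  from filterlim_compose[OF this n]
  show "(\<lambda>j. overhead (n j) (n j) l) \<longlonglongrightarrow> 0"
    unfolding overhead_def a_def using b by (rule tendsto_add_zero)
  have "\<forall>\<^sub>F j in sequentially. 4 / l < real (n j)"
    using n by (simp add: filterlim_at_top_dense)
  then show "\<forall>\<^sub>F j in sequentially. 0 < real (\<Delta> j) / real (n j) * ln 2 + overhead (n j) (\<Delta> j) l"
  proof eventually_elim
    case (elim j)
    then have "4 < real (n j) * l" using assms(2) by (simp add: field_simps)
    moreover have "0 \<le> real_of_int \<lceil>l\<rceil>" using assms(2) by linarith
    ultimately have "0 \<le> overhead (n j) (\<Delta> j) l" by (simp add: overhead_def)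
    then show ?case using pos[of j] by (intro add_pos_nonneg) auto
  qed
qed

context
  fixes L :: "real poly" and \<epsilon> l \<xi> h :: real and n \<Delta> :: "nat \<Rightarrow> nat"
  assumes l_eq: "avg_degree L = l" and \<xi>_eq: "real (min_degree L) * \<epsilon> = \<xi>"
    and l: "2 \<le> l" and \<xi>: "0 < \<xi>" "\<xi> < l / 2"
    and adm: "admissible n \<Delta>" and h: "0 \<le> h"
begin

text \<open>The approach from strictly above decides the borderline case: if \<open>h * ln 2\<close>
  equals \<open>neg_exponent l \<xi> 1\<close>, the second branch of \<open>R_finite\<close> is
  eventually taken.\<close>

lemma target_limit:
  "(\<lambda>j. (h + real (\<Delta> j) / real (n j)) * ln 2 + overhead (n j) (\<Delta> j) l) \<longlonglongrightarrow> h * ln 2"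
  "\<forall>\<^sub>F j in sequentially. h * ln 2 < (h + real (\<Delta> j) / real (n j)) * ln 2 + overhead (n j) (\<Delta> j) l"
proof -
  have "(\<lambda>j. (h + real (\<Delta> j) / real (n j)) * ln 2 + overhead (n j) (\<Delta> j) l) \<longlonglongrightarrow> (h + 0) * ln 2 + 0"
    using admissible_limits[OF adm, of l] l by (intro tendsto_intros) auto
  then show "(\<lambda>j. (h + real (\<Delta> j) / real (n j)) * ln 2 + overhead (n j) (\<Delta> j) l) \<longlonglongrightarrow> h * ln 2"
    by simp
  have "\<forall>\<^sub>F j in sequentially. 0 < real (\<Delta> j) / real (n j) * ln 2 + overhead (n j) (\<Delta> j) l"
    using admissible_limits(4)[OF adm, of l] l by simp
  then show "\<forall>\<^sub>F j in sequentially. h * ln 2 < (h + real (\<Delta> j) / real (n j)) * ln 2 + overhead (n j) (\<Delta> j) l"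
    by eventually_elim (simp add: distrib_right)
qed

text \<open>A continuous injective function on a compact interval has a continuous inverse, so the
  solutions for the convergent right-hand sides converge to the solution for
  \<open>h * ln 2\<close>.\<close>

lemma R_lim_low:
  assumes "h * ln 2 < neg_exponent l \<xi> 1"
  shows "R_lim n \<Delta> L \<epsilon> h \<in> {0..1}" "neg_exponent l \<xi> (R_lim n \<Delta> L \<epsilon> h) = h * ln 2"
proof -
  let ?Q = "neg_exponent l \<xi>"
  define y where "y = (\<lambda>j. (h + real (\<Delta> j) / real (n j)) * ln 2 + overhead (n j) (\<Delta> j) l)"
  have lim: "y \<longlonglongrightarrow> h * ln 2" unfolding y_def by (rule target_limit)
  have ev: "\<forall>\<^sub>F j in sequentially. 0 < y j \<and> y j < ?Q 1"
    using target_limit(2) order_tendstoD(2)[OF lim assms]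
  proof eventually_elim
    case (elim j)
    moreover have "0 \<le> h * ln 2" using h by simp
    ultimately show ?case unfolding y_def by linarith
  qed
  obtain R where R: "0 \<le> R" "R \<le> 1" "?Q R = h * ln 2"
    using neg_exponent_surj[OF l \<xi>, of "h * ln 2"] assms h by auto
  define S where "S = (\<lambda>j. R_finite (n j) (\<Delta> j) L \<epsilon> h)"
  have S: "\<forall>\<^sub>F j in sequentially. S j \<in> {0..1} \<and> ?Q (S j) = y j"
    using ev
  proof eventually_elim
    case (elim j)
    then show ?case
      using R_finite_low[OF l_eq \<xi>_eq l \<xi>, of "y j" h "\<Delta> j" "n j"] by (auto simp: y_def S_def)
  qed
  let ?inv = "inv_into {0..1} ?Q"
  have inv: "\<forall>x\<in>{0..1}. ?inv (?Q x) = x"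
    using neg_exponent_inj[OF l \<xi>] by simp
  have cont: "continuous_on (?Q ` {0..1}) ?inv"
    by (rule continuous_on_inv[OF neg_exponent_continuous[OF l \<xi>] compact_Icc inv])
  have "h * ln 2 \<in> ?Q ` {0..1}"
    unfolding R(3)[symmetric] using R by (intro imageI) simp
  moreover have "\<forall>\<^sub>F j in sequentially. y j \<in> ?Q ` {0..1}"
    using S by eventually_elim (auto intro: rev_image_eqI)
  ultimately have "(\<lambda>j. ?inv (y j)) \<longlonglongrightarrow> ?inv (h * ln 2)"
    by (rule continuous_on_tendsto_compose[OF cont lim])
  also have "?inv (h * ln 2) = R"
  proof -
    have "?inv (?Q R) = R" using R by (intro inv[rule_format]) simp
    then show ?thesis by (simp only: R(3))
  qed
  finally have "(\<lambda>j. ?inv (y j)) \<longlonglongrightarrow> R" .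
  moreover have "\<forall>\<^sub>F j in sequentially. ?inv (y j) = S j"
    using S
  proof eventually_elim
    case (elim j)
    then have "?inv (?Q (S j)) = S j" by (intro inv[rule_format]) simp
    then show ?case using elim by simp
  qed
  ultimately have "S \<longlonglongrightarrow> R" by (rule Lim_transform_eventually)
  then have "R_lim n \<Delta> L \<epsilon> h = R" unfolding R_lim_def S_def by (rule limI)
  then show "R_lim n \<Delta> L \<epsilon> h \<in> {0..1}" "neg_exponent l \<xi> (R_lim n \<Delta> L \<epsilon> h) = h * ln 2"
    using R by auto
qed

lemma R_lim_high:
  assumes "neg_exponent l \<xi> 1 \<le> h * ln 2"
  shows "R_lim n \<Delta> L \<epsilon> h = 2 - neg_exponent l \<xi> 1 / ln 2"
proof -
  have "(\<lambda>j. 2 + 1 / ln 2 * (overhead (n j) (n j) l - neg_exponent l \<xi> 1))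
     \<longlonglongrightarrow> 2 + 1 / ln 2 * (0 - neg_exponent l \<xi> 1)"
    using admissible_limits[OF adm, of l] l by (intro tendsto_intros) auto
  moreover have "\<forall>\<^sub>F j in sequentially. 2 + 1 / ln 2 * (overhead (n j) (n j) l - neg_exponent l \<xi> 1)
      = R_finite (n j) (\<Delta> j) L \<epsilon> h"
    using target_limit(2)
    by eventually_elim (use R_finite_high[OF l_eq \<xi>_eq l \<xi>] assms in simp)
  ultimately have "(\<lambda>j. R_finite (n j) (\<Delta> j) L \<epsilon> h) \<longlonglongrightarrow> 2 + 1 / ln 2 * (0 - neg_exponent l \<xi> 1)"
    by (rule Lim_transform_eventually)
  then show ?thesis unfolding R_lim_def by (simp add: limI)
qed

text \<open>Let \<eta> be the power on the right. Below the threshold the gap is at most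
  \<open>\<eta> / ln 2\<close>. Above it the gap is \<open>2 - q - h\<close> with
  \<open>q = neg_exponent l \<xi> 1 / ln 2\<close>, and
  \<open>1 - \<eta> / ln 2 \<le> q \<le> h\<close> produces the factor 2; \<open>q \<le> 1\<close>
  gives the sign for \<open>h \<le> 1\<close>.\<close>

lemma R_lim_bounds:
  "R_lim n \<Delta> L \<epsilon> h - h \<le> 2 * ((1 - 2 * \<xi> / l) ^ r1 l / ln 2)"
  "h \<le> 1 \<Longrightarrow> 0 \<le> R_lim n \<Delta> L \<epsilon> h - h"
proof -
  let ?Q = "neg_exponent l \<xi>" and ?\<eta> = "(1 - 2 * \<xi> / l) ^ r1 l"
  have \<eta>: "0 \<le> ?\<eta>" using l \<xi> by (simp add: field_simps)
  have *: "R_lim n \<Delta> L \<epsilon> h - h \<le> 2 * (?\<eta> / ln 2) \<and> (h \<le> 1 \<longrightarrow> 0 \<le> R_lim n \<Delta> L \<epsilon> h - h)"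
  proof (cases "h * ln 2 < ?Q 1")
    case True
    define R where "R = R_lim n \<Delta> L \<epsilon> h"
    have R: "0 \<le> R" "R \<le> 1" "?Q R = h * ln 2" using R_lim_low[OF True] by (auto simp: R_def)
    have "R * ln 2 - ?\<eta> \<le> h * ln 2" "h * ln 2 \<le> R * ln 2"
      using neg_exponent_le[OF l \<xi>, of R] neg_exponent_ge[OF l \<xi>, of R] R by auto
    then have "(R - h) * ln 2 \<le> 2 * ?\<eta>" "h \<le> R" using \<eta> by (simp_all add: left_diff_distrib)
    then show ?thesis unfolding R_def[symmetric] by (simp add: pos_le_divide_eq)
  next
    case False
    then have eq: "R_lim n \<Delta> L \<epsilon> h = 2 - ?Q 1 / ln 2" by (intro R_lim_high) simp
    have "?Q 1 / ln 2 \<le> h" using False by (simp add: pos_divide_le_eq)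
    moreover have "(ln 2 - ?\<eta>) / ln 2 \<le> ?Q 1 / ln 2"
      using neg_exponent_ge[OF l \<xi>, of 1] by (intro divide_right_mono) simp_all
    then have "1 - ?\<eta> / ln 2 \<le> ?Q 1 / ln 2" by (simp add: diff_divide_distrib)
    moreover have "?Q 1 / ln 2 \<le> 1"
      using neg_exponent_le[OF l \<xi>, of 1] by (simp add: pos_divide_le_eq)
    ultimately show ?thesis unfolding eq by (intro conjI impI; linarith)
  qed
  then show "R_lim n \<Delta> L \<epsilon> h - h \<le> 2 * (?\<eta> / ln 2)" "h \<le> 1 \<Longrightarrow> 0 \<le> R_lim n \<Delta> L \<epsilon> h - h" by auto
qed

end

subsection \<open>Degrees of \<open>L(z\<^sup>k)\<close> and the entropy term\<close>

text \<open>One \<open>pCons\<close> step shifts indices by \<open>k\<close>, which changes the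
  quotient \<open>i div k\<close> by one and keeps divisibility; below \<open>k\<close> the index 0
  is the sole multiple of \<open>k\<close>.\<close>

lemma coeff_expand:
  assumes "0 < k"
  shows "coeff (expand L k) i = (if k dvd i then coeff L (i div k) else 0)"
proof (induction L arbitrary: i)
  case 0
  then show ?case by (simp add: expand_def)
next
  case (pCons a p)
  have "expand (pCons a p) k = [:a:] + monom 1 k * expand p k"
    by (simp add: expand_def pcompose_pCons)
  then have "coeff (expand (pCons a p) k) i
      = coeff [:a:] i + (if i < k then 0 else coeff (expand p k) (i - k))"
    by (simp add: coeff_monom_mult)
  also have "\<dots> = (if k dvd i then coeff (pCons a p) (i div k) else 0)"
  proof (cases "i < k")
    case True
    then show ?thesis using assms by (auto simp: coeff_pCons dvd_imp_le split: nat.splits dest: dvd_imp_le)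
  next
    case False
    then have "i div k = Suc ((i - k) div k)" "k dvd i \<longleftrightarrow> k dvd (i - k)" "i \<noteq> 0"
      using assms by (simp_all add: le_div_geq dvd_minus_self)
    then show ?thesis using False pCons.IH[of "i - k"] by (simp add: coeff_pCons split: nat.splits)
  qed
  finally show ?case .
qed

lemma coeff_min_degree: "L \<noteq> 0 \<Longrightarrow> coeff L (min_degree L) \<noteq> 0"
  unfolding min_degree_def using leading_coeff_neq_0 by (rule LeastI)

lemma min_degree_expand:
  assumes "0 < k" "L \<noteq> 0"
  shows "min_degree (expand L k) = k * min_degree L"
  unfolding min_degree_def[of "expand L k"]
proof (rule Least_equality)
  show "coeff (expand L k) (k * min_degree L) \<noteq> 0"
    using assms coeff_min_degree by (simp add: coeff_expand)
  fix i assume "coeff (expand L k) i \<noteq> 0"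
  then obtain m where "i = k * m" "coeff L m \<noteq> 0"
    using assms by (auto simp: coeff_expand split: if_splits)
  then show "k * min_degree L \<le> i" unfolding min_degree_def by (simp add: Least_le)
qed

text \<open>Chain rule at 1, where the inner monomial has value 1 and derivative
  \<open>k\<close>.\<close>

lemma avg_degree_expand: "avg_degree (expand L k) = real k * avg_degree L"
  by (simp add: avg_degree_def expand_def pderiv_pcompose pderiv_monom poly_pcompose poly_monom)

lemma avg_degree_sum: "avg_degree L = (\<Sum>i\<le>degree L. real i * coeff L i)"
proof -
  have "pderiv (sum f A) = (\<Sum>i\<in>A. pderiv (f i))" for f :: "nat \<Rightarrow> real poly" and A
    by (induction A rule: infinite_finite_induct) (simp_all add: pderiv_add)
  then have "pderiv L = (\<Sum>i\<le>degree L. pderiv (monom (coeff L i) i))"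
    by (metis poly_as_sum_of_monoms)
  then show ?thesis by (simp add: avg_degree_def poly_sum pderiv_monom poly_monom)
qed

lemma min_degree_le_avg_degree:
  assumes "normalized_degree_distribution L"
  shows "real (min_degree L) \<le> avg_degree L"
proof -
  have "real (min_degree L) = (\<Sum>i\<le>degree L. real (min_degree L) * coeff L i)"
    using assms by (simp add: sum_distrib_left[symmetric] normalized_degree_distribution_def)
  also have "\<dots> \<le> (\<Sum>i\<le>degree L. real i * coeff L i)"
  proof (rule sum_mono)
    fix i
    show "real (min_degree L) * coeff L i \<le> real i * coeff L i"
    proof (cases "coeff L i = 0")
      case False
      then have "min_degree L \<le> i" unfolding min_degree_def by (rule Least_le)
      then show ?thesis using assms by (intro mult_right_mono) (auto simp: normalized_degree_distribution_def)
    qed simp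
  qed
  finally show ?thesis by (simp add: avg_degree_sum)
qed

lemma normalized_degree_distribution_nonzero: "normalized_degree_distribution L \<Longrightarrow> L \<noteq> 0"
  by (auto simp: normalized_degree_distribution_def)

section \<open>Estimates for \<open>\<epsilon> = ln k / (2 * k)\<close>\<close>

lemma half_le_ln:
  assumes "2 \<le> k" shows "1 / 2 \<le> ln (k::real)"
proof -
  have "exp (1 / 2) * exp (1 / 2) \<le> (2 * 2 :: real)"
    using exp_le by (simp flip: exp_add)
  then have "exp (1 / 2 :: real) \<le> 2" using mult_strict_mono'[of 2 "exp (1/2)" 2 "exp (1/2::real)"] by force
  then show ?thesis using assms by (subst ln_ge_iff) auto
qed

text \<open>The 5 is 3 + 2: \<open>- ln \<epsilon> \<le> 3 * ln k\<close> bounds the first entropy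
  term, and the second is at most \<open>\<epsilon> \<le> 2 * \<epsilon> * ln k\<close>. The factor
  1/2 in \<epsilon> pays for the division by \<open>ln 2 \<ge> 1 / 2\<close>.\<close>

lemma entropy_2_small:
  fixes k :: real
  assumes "2 \<le> k"
  defines "\<epsilon> \<equiv> ln k / (2 * k)"
  shows "0 < \<epsilon>" "\<epsilon> < 1 / 2" "0 \<le> entropy_2 \<epsilon>" "entropy_2 \<epsilon> \<le> 5 * ((ln k)\<^sup>2 / k)"
proof -
  have lnk: "1 / 2 \<le> ln k" using assms by (intro half_le_ln)
  have "ln k \<le> k - 1" using assms by (intro ln_le_minus_one) auto
  then show \<epsilon>: "0 < \<epsilon>" "\<epsilon> < 1 / 2" using assms lnk by (auto simp: field_simps)
  have e2: "entropy_2 \<epsilon> = entropy_e \<epsilon> / ln 2"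
    by (simp add: entropy_2_def entropy_e_def log_def diff_divide_distrib)
  have a0: "0 \<le> - \<epsilon> * ln \<epsilon>" using \<epsilon> by (intro mult_nonpos_nonpos) auto
  have b0: "0 \<le> - ((1 - \<epsilon>) * ln (1 - \<epsilon>))" using \<epsilon> by (simp add: mult_nonneg_nonpos)
  show "0 \<le> entropy_2 \<epsilon>" unfolding e2 entropy_e_def using a0 b0 by simp
  have "- ln \<epsilon> = ln (1 / \<epsilon>)" using \<epsilon> by (simp add: ln_div)
  \<comment> \<open>\<open>1 / \<epsilon> = 2 * k / ln k\<close> and
    \<open>ln k \<ge> 1 / 2\<close>.\<close>
  also have "\<dots> \<le> ln (4 * k)" using \<epsilon> lnk assms by (subst ln_le_cancel_iff) (auto simp: field_simps)
  also have "\<dots> = 2 * ln 2 + ln k"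
    using assms ln_realpow[of 2 2] by (simp add: ln_mult)
  also have "\<dots> \<le> 3 * ln k" using assms by simp
  finally have "\<epsilon> * (- ln \<epsilon>) \<le> \<epsilon> * (3 * ln k)" using \<epsilon> by (intro mult_left_mono) auto
  moreover have "- ((1 - \<epsilon>) * ln (1 - \<epsilon>)) \<le> \<epsilon>"
  proof -
    have "- ln (1 - \<epsilon>) \<le> 1 / (1 - \<epsilon>) - 1"
      using ln_le_minus_one[of "1 / (1 - \<epsilon>)"] \<epsilon> by (simp add: ln_div)
    then have "(1 - \<epsilon>) * (- ln (1 - \<epsilon>)) \<le> (1 - \<epsilon>) * (1 / (1 - \<epsilon>) - 1)"
      using \<epsilon> by (intro mult_left_mono) auto
    also have "\<dots> = \<epsilon>" using \<epsilon> by (simp add: right_diff_distrib)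
    finally show ?thesis by simp
  qed
  moreover have "\<epsilon> * 1 \<le> \<epsilon> * (2 * ln k)" using \<epsilon> lnk by (intro mult_left_mono) auto
  ultimately have "entropy_e \<epsilon> \<le> \<epsilon> * (5 * ln k)" unfolding entropy_e_def by (simp add: algebra_simps)
  also have "\<dots> = 5 * ((ln k)\<^sup>2 / k) * (1 / 2)" by (simp add: \<epsilon>_def power2_eq_square)
  also have "\<dots> \<le> 5 * ((ln k)\<^sup>2 / k) * ln 2"
    using half_le_ln[of 2] assms by (intro mult_left_mono) auto
  finally show "entropy_2 \<epsilon> \<le> 5 * ((ln k)\<^sup>2 / k)" unfolding e2 by (simp add: pos_divide_le_eq)
qed

text \<open>With \<open>u = 2 * \<xi> / l\<close> the power is at most
  \<open>exp (- u * r1 l)\<close>, and \<open>u * r1 l \<ge> u * (l - 1) \<ge> 2 * ln k - 1\<close>: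
  rounding down \<open>l\<close> costs the factor \<open>exp 1\<close> in
  \<open>exp 1 / k^2\<close>. The 8 combines \<open>1 \<le> 4 * (ln k)^2\<close> with
  \<open>1 / ln 2 \<le> 2\<close>.\<close>

lemma collision_bound:
  fixes k l :: real
  assumes k: "2 \<le> k" and l: "0 < l" and \<xi>: "0 < \<xi>" "2 * \<xi> \<le> l" and ln_k: "ln k \<le> \<xi>"
  shows "(1 - 2 * \<xi> / l) ^ r1 l / ln 2 \<le> 8 * exp 1 * ((ln k)\<^sup>2 / k)"
proof -
  define u where "u = 2 * \<xi> / l"
  have u: "0 < u" "u \<le> 1" "u * l = 2 * \<xi>" using l \<xi> by (auto simp: u_def)
  have "l - 1 \<le> real (r1 l)" unfolding r1_def using l by linarith
  then have "u * (l - 1) \<le> u * real (r1 l)" using u by (intro mult_left_mono) auto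
  then have le: "2 * ln k - 1 \<le> u * real (r1 l)" using u ln_k by (simp add: right_diff_distrib)
  have "1 - u \<le> exp (- u)" using exp_ge_add_one_self[of "- u"] by simp
  then have "(1 - u) ^ r1 l \<le> exp (- u) ^ r1 l" using u by (intro power_mono) auto
  also have "\<dots> = exp (- (u * real (r1 l)))" by (simp add: exp_of_nat_mult[symmetric] mult.commute)
  also have "\<dots> \<le> exp (1 - 2 * ln k)" using le by simp
  also have "\<dots> = exp 1 / k\<^sup>2"
    using k by (simp add: exp_diff exp_of_nat_mult[of 2 "ln k", simplified])
  also have "\<dots> \<le> exp 1 * (4 * (ln k)\<^sup>2 / k)"
  proof -
    have "(1 / 2)\<^sup>2 \<le> (ln k)\<^sup>2" using half_le_ln[OF k] by (intro power_mono) auto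
    then have "1 \<le> 4 * (ln k)\<^sup>2" by (simp add: power2_eq_square)
    then have "1 / k\<^sup>2 \<le> 4 * (ln k)\<^sup>2 / k"
      using k by (intro frac_le) (auto simp: power2_eq_square)
    then have "exp 1 * (1 / k\<^sup>2) \<le> exp 1 * (4 * (ln k)\<^sup>2 / k)" by (intro mult_left_mono) auto
    then show ?thesis by simp
  qed
  finally have "(1 - u) ^ r1 l \<le> 8 * exp 1 * ((ln k)\<^sup>2 / k) * (1 / 2)" by (simp add: mult_ac)
  also have "\<dots> \<le> 8 * exp 1 * ((ln k)\<^sup>2 / k) * ln 2"
    using half_le_ln[of 2] k by (intro mult_left_mono) auto
  finally show ?thesis unfolding u_def by (simp add: pos_divide_le_eq)
qed

theorem proposition2:
  fixes L :: "real poly"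
  assumes "normalized_degree_distribution L"
    and "min_degree L \<ge> 2"
  shows "\<exists>C::real. \<forall>n \<Delta>. admissible n \<Delta> \<longrightarrow>
           (\<forall>(k::nat) (h::real). exp (2 / real (min_degree L)) \<le> real k \<and> 0 \<le> h \<longrightarrow>
              r_lim n \<Delta> (expand L k) (ln (real k) / (2 * real k)) h \<le> C * ((ln (real k))\<^sup>2 / real k) \<and>
              (h \<le> 1 \<longrightarrow>
                \<bar>r_lim n \<Delta> (expand L k) (ln (real k) / (2 * real k)) h\<bar> \<le> C * ((ln (real k))\<^sup>2 / real k)))"
proof (intro exI[of _ "16 * exp 1 + 5"] allI impI)
  fix n \<Delta> :: "nat \<Rightarrow> nat" and k :: nat and h :: real
  assume adm: "admissible n \<Delta>" and kh: "exp (2 / real (min_degree L)) \<le> real k \<and> 0 \<le> h"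
  define \<epsilon> where "\<epsilon> = ln (real k) / (2 * real k)"
  define l where "l = real k * avg_degree L"
  define \<xi> where "\<xi> = real (k * min_degree L) * \<epsilon>"
  define q where "q = (ln (real k))\<^sup>2 / real k"
  have L0: "L \<noteq> 0" using assms(1) by (rule normalized_degree_distribution_nonzero)
  have avg: "real (min_degree L) \<le> avg_degree L" using assms(1) by (rule min_degree_le_avg_degree)
  have "1 < exp (2 / real (min_degree L))" using assms(2) by simp
  \<comment> \<open>The exponential exceeds 1 and \<open>k\<close> is an integer.\<close>
  then have k: "2 \<le> k" using kh by linarith
  have \<epsilon>: "0 < \<epsilon>" "\<epsilon> < 1 / 2" and H: "0 \<le> entropy_2 \<epsilon>" "entropy_2 \<epsilon> \<le> 5 * q"
    using entropy_2_small[of "real k"] k by (auto simp: \<epsilon>_def q_def)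
  have "2 \<le> avg_degree L" using avg assms(2) by linarith
  then have "2 * 2 \<le> l" unfolding l_def using k by (intro mult_mono) auto
  then have l: "2 \<le> l" by simp
  have \<xi>0: "0 < \<xi>" using \<epsilon> k assms(2) by (simp add: \<xi>_def)
  \<comment> \<open>\<open>\<epsilon> < 1 / 2\<close> and the comparison of minimum and average
    degree put \<xi> below \<open>l / 2\<close>, the range in which the saddle point lies in (0,
    1).\<close>
  have "real k * (real (min_degree L) * \<epsilon>) < real k * (real (min_degree L) * (1 / 2))"
    using \<epsilon> k assms(2) by (intro mult_strict_left_mono) auto
  also have "\<dots> \<le> real k * (avg_degree L * (1 / 2))"
    using avg by (intro mult_left_mono mult_right_mono) auto
  finally have \<xi>1: "\<xi> < l / 2" by (simp add: \<xi>_def l_def)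
  have \<xi>_eq: "\<xi> = real (min_degree L) / 2 * ln (real k)" using k by (simp add: \<xi>_def \<epsilon>_def)
  \<comment> \<open>Since the minimum degree is at least 2, \<xi> reaches \<open>ln k\<close>, which
    gives \<open>collision_bound\<close> its decay of order \<open>1 / k^2\<close>.\<close>
  have "1 * ln (real k) \<le> \<xi>"
    unfolding \<xi>_eq using assms(2) k by (intro mult_right_mono) auto
  then have \<eta>: "(1 - 2 * \<xi> / l) ^ r1 l / ln 2 \<le> 8 * exp 1 * q"
    unfolding q_def using k l \<xi>0 \<xi>1 by (intro collision_bound) auto
  have "avg_degree (expand L k) = l" by (simp add: l_def avg_degree_expand)
  moreover have "real (min_degree (expand L k)) * \<epsilon> = \<xi>"
    using k L0 by (simp add: \<xi>_def min_degree_expand)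
  ultimately have R: "R_lim n \<Delta> (expand L k) \<epsilon> h - h \<le> 2 * ((1 - 2 * \<xi> / l) ^ r1 l / ln 2)"
    "h \<le> 1 \<Longrightarrow> 0 \<le> R_lim n \<Delta> (expand L k) \<epsilon> h - h"
    using R_lim_bounds[of "expand L k" l \<epsilon> \<xi> n \<Delta> h] l \<xi>0 \<xi>1 adm kh by blast+
  \<comment> \<open>\<open>16 * exp 1\<close> is the constant of \<open>collision_bound\<close>
    doubled by \<open>R_lim_bounds\<close>; the 5 comes from the entropy.\<close>
  have "r_lim n \<Delta> (expand L k) \<epsilon> h \<le> (16 * exp 1 + 5) * q"
    using R(1) \<eta> H by (simp add: r_lim_def distrib_right)
  moreover have "0 \<le> r_lim n \<Delta> (expand L k) \<epsilon> h" if "h \<le> 1"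
    using R(2)[OF that] H by (simp add: r_lim_def)
  ultimately show "r_lim n \<Delta> (expand L k) (ln (real k) / (2 * real k)) h
        \<le> (16 * exp 1 + 5) * ((ln (real k))\<^sup>2 / real k) \<and>
      (h \<le> 1 \<longrightarrow> \<bar>r_lim n \<Delta> (expand L k) (ln (real k) / (2 * real k)) h\<bar>
        \<le> (16 * exp 1 + 5) * ((ln (real k))\<^sup>2 / real k))"
    unfolding \<epsilon>_def[symmetric] q_def[symmetric] by simp
qed

end
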